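(* For every field $F$, every integer $n>1$, and every subset $S\subseteq \mathrm{Mat}_n(F)$, $$\ell(S)\leq 2n\log_2 n-2n\log_2\log_2 n+5n.$$ In particular, $L(\mathrm{Mat}_n(F))\leq 2n\log_2 n-2n\log_2\log_2 n+5n$.
   Context: $\mathrm{Mat}_n(F)$ denotes the algebra of $n\times n$ matrices over $F$. For $S\subseteq \mathrm{Mat}_n(F)$ and an integer $k\geq 0$, $FS^{\leq k}:=\mathrm{Span}_F\{s_1s_2\cdots s_j : 0\leq j\leq k,\ s_i\in S\}$ is the $F$-linear span of all words in $S$ of length at most $k$, where the empty word ($j=0$) contributes the identity matrix. $F[S]$ denotes the unital $F$-subalgebra of $\mathrm{Mat}_n(F)$ generated by $S$. The length $\ell(S)$ is the least $k\ge 0$ such that $FS^{\leq k}=F[S]$. The length of the full matrix algebra is $L(\mathrm{Mat}_n(F)):=\max\{\ell(S) : S\subseteq \mathrm{Mat}_n(F),\ F[S]=\mathrm{Mat}_n(F)\}$. *)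

theory Defs
  imports Complex_Main "Jordan_Normal_Form.VS_Connect"
begin

text \<open>
  \<open>Mat\<^sub>n(F)\<close> is \<open>carrier_mat n n\<close>, for matrices with entries in a type of class \<open>field\<close>; its
  vector space structure is \<open>module_mat TYPE('a) n n\<close> over \<open>class_ring\<close>. Sets of matrices are
  meant to be subsets of \<open>carrier_mat n n\<close>, which is assumed wherever the notions are used.
\<close>

abbreviation mat_span :: "nat \<Rightarrow> 'a::field mat set \<Rightarrow> 'a mat set" where
  "mat_span n \<equiv> LinearCombinations.module.span class_ring (module_mat TYPE('a) n n)"

definition word_prod :: "nat \<Rightarrow> 'a::field mat list \<Rightarrow> 'a mat" where
  "word_prod n w = foldr (*) w (1\<^sub>m n)"

text \<open>\<open>FS\<^sup>\<le>\<^sup>k\<close>:\<close>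

definition words_span :: "nat \<Rightarrow> 'a::field mat set \<Rightarrow> nat \<Rightarrow> 'a mat set" where
  "words_span n S k = mat_span n {word_prod n w | w. set w \<subseteq> S \<and> length w \<le> k}"

definition unital_subalgebra :: "nat \<Rightarrow> 'a::field mat set \<Rightarrow> bool" where
  "unital_subalgebra n A \<longleftrightarrow>
     VectorSpace.subspace class_ring A (module_mat TYPE('a) n n) \<and>
     1\<^sub>m n \<in> A \<and> (\<forall>X\<in>A. \<forall>Y\<in>A. X * Y \<in> A)"

text \<open>\<open>F[S]\<close>, the least unital subalgebra of \<open>Mat\<^sub>n(F)\<close> containing \<open>S\<close>:\<close>

definition gen_algebra :: "nat \<Rightarrow> 'a::field mat set \<Rightarrow> 'a mat set" where
  "gen_algebra n S = unital_subalgebra n hull S"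

text \<open>\<open>\<ell>(S)\<close>; a suitable \<open>k\<close> exists because \<open>Mat\<^sub>n(F)\<close> is finite dimensional.\<close>

definition alg_length :: "nat \<Rightarrow> 'a::field mat set \<Rightarrow> nat" where
  "alg_length n S = (LEAST k. words_span n S k = gen_algebra n S)"

text \<open>\<open>L(Mat\<^sub>n(F))\<close>. The set is nonempty, since \<open>carrier_mat n n\<close> generates itself, and bounded,
  since each \<open>\<ell>(S)\<close> is at most \<open>n\<^sup>2\<close>.\<close>

definition full_length :: "'a::field itself \<Rightarrow> nat \<Rightarrow> nat" where
  "full_length _ n =
     Max {alg_length n S | S :: 'a mat set. S \<subseteq> carrier_mat n n \<and> gen_algebra n S = carrier_mat n n}"

end

theory Submission
  imports Defs "HOL-Algebra.Algebraic_Closure_Type" "HOL-Library.Function_Algebras"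
begin

text \<open>
  Over the algebraic closure \<open>K\<close> of \<open>F\<close>, let the letters \<open>S\<close> act irreducibly on a space \<open>V\<close> of
  dimension \<open>n\<close>. The proof looks for an operator of rank one among the combinations of short words:
  once there is one, multiplying it by words of length below \<open>n\<close> on both sides gives every operator
  on \<open>V\<close> (\<open>irreducible_full\<close>).

  An operator of rank one is reached from the identity by lowering the rank while controlling the
  product of length and rank. Let \<open>A\<close> be a combination of words of length at most \<open>k\<close>, of rank \<open>r > 1\<close>
  and with image \<open>U\<close>. Irreducibility gives a word \<open>w\<close> for which \<open>H = A w\<close> is not scalar on \<open>U\<close>; take a
  shortest one, of length \<open>L\<close>. Call a subspace \<open>Z\<close> of \<open>U\<close> transversal if no nonzero \<open>z\<close> in \<open>Z\<close> has
  \<open>H z\<close> in \<open>Z\<close>. All words shorter than \<open>w\<close> act as scalars on \<open>U\<close> after applying \<open>A\<close>, and this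
  forces the images of \<open>Z\<close> under the \<open>L + 1\<close> suffixes of \<open>w\<close> to be independent subspaces of \<open>V\<close>, so that
  \<open>(L + 1) dim Z \<le> n\<close> (\<open>transversal_packing\<close>). Hence \<open>w\<close> is short when there is a large transversal
  subspace. On the other hand, some product of \<open>d - 1\<close> factors \<open>H - l\<close> has rank \<open>q > 0\<close> with
  \<open>d q \<le> r\<close>; composed with \<open>A\<close> it is a combination of words of length at most \<open>k' = d k + (d - 1) L\<close>.
  If \<open>d = 2\<close> there is a transversal \<open>Z\<close> of dimension \<open>q\<close>, and \<open>k' q \<le> k r + n\<close>. If \<open>d \<ge> 3\<close> there is one
  with \<open>2 dim Z \<ge> (d - 1) q\<close>, and \<open>k' q \<le> k r + 2 n\<close>. So \<open>k r\<close> grows by at most \<open>n\<close> in a step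
  that divides the rank by at least two, and by at most \<open>2 n\<close> in one that divides it by at least three
  (\<open>rank_reduction\<close>). As \<open>2 \<le> (3/2) log\<^sub>2 3\<close>, in both cases
  \<open>k r \<le> (3/2) n log\<^sub>2 (n / r)\<close> persists, and at rank one \<open>k \<le> (3/2) n log\<^sub>2 n\<close>.

  The general case follows along a chain of invariant subspaces: if words of length \<open>j + 1\<close> are
  combinations of shorter ones on \<open>M / P\<close>, and words of length \<open>k + 1\<close> on \<open>P / N\<close>, then words of length
  \<open>j + k + 2\<close> are so on \<open>M / N\<close> (\<open>reduces_trans\<close>), and the bound is superadditive. An \<open>F\<close>-linear retraction
  of \<open>K\<close> onto \<open>F\<close>, applied to the entries, turns a linear relation over \<open>K\<close> between matrices over \<open>F\<close> into one
  over \<open>F\<close>. The result is \<open>\<ell>(S) \<le> (3/2) n log\<^sub>2 n + 2 n - 2\<close>, which is below the bound of the theorem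
  because \<open>2 log\<^sub>2 x \<le> x / 2 + 3\<close> for \<open>x = log\<^sub>2 n\<close> (\<open>log_log_bound\<close>).
\<close>

hide_const (open) UnivPoly.up_ring.coeff UnivPoly.up_ring.monom Polynomials.degree

section \<open>Finite-dimensional subspaces\<close>

text \<open>
  Subspaces of one ambient space of arbitrary dimension stand for all the finite-dimensional spaces
  that occur, so that dimensions can vary within a proof. An operator is a linear map of the whole
  ambient space; only its restriction to some subspace matters.
\<close>

locale operator_space = vector_space scale
  for scale :: "'a::alg_closed_field \<Rightarrow> 'b::ab_group_add \<Rightarrow> 'b" (infixr \<open>*s\<close> 75)
begin

sublocale endo: vector_space_pair scale scale ..

abbreviation operator :: "('b \<Rightarrow> 'b) \<Rightarrow> bool" where
  "operator \<equiv> Vector_Spaces.linear scale scale"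

definition fin_dim :: "'b set \<Rightarrow> bool" where
  "fin_dim V \<longleftrightarrow> (\<exists>B. finite B \<and> V \<subseteq> span B)"

lemma fin_dim_subset: "fin_dim V \<Longrightarrow> W \<subseteq> V \<Longrightarrow> fin_dim W"
  unfolding fin_dim_def by blast

lemma fin_dim_span_Un: 
  assumes "fin_dim V" "fin_dim W" shows "fin_dim (span (V \<union> W))"
proof -
  obtain B C where "finite B" "V \<subseteq> span B" "finite C" "W \<subseteq> span C"
    using assms unfolding fin_dim_def by blast
  then have "finite (B \<union> C)" "V \<union> W \<subseteq> span (B \<union> C)"
    using span_mono[of B "B \<union> C"] span_mono[of C "B \<union> C"] by auto
  then show ?thesis unfolding fin_dim_def by (meson span_minimal subspace_span)
qed

lemma fin_dim_extend_basis:
  assumes "fin_dim V" "B \<subseteq> V" "independent B"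
  obtains C where "B \<subseteq> C" "C \<subseteq> V" "finite C" "independent C" "V \<subseteq> span C" "card C = dim V"
proof -
  obtain C where C: "B \<subseteq> C" "C \<subseteq> V" "independent C" "V \<subseteq> span C"
    using maximal_independent_subset_extend[OF assms(2,3)] by blast
  obtain D where "finite D" "V \<subseteq> span D" using assms(1) unfolding fin_dim_def by blast
  then have "finite C" using independent_span_bound[of D C] C(2,3) by auto
  then show ?thesis using that[of C] C basis_card_eq_dim[of C V] by simp
qed

lemma fin_dim_basis:
  assumes "fin_dim V"
  obtains C where "C \<subseteq> V" "finite C" "independent C" "V \<subseteq> span C" "card C = dim V"
  using fin_dim_extend_basis[OF assms, of "{}"] by (auto simp: independent_empty)

lemma dim_mono_fin_dim:
  assumes "fin_dim V" "W \<subseteq> V" shows "dim W \<le> dim V"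
proof -
  obtain C where "finite C" "V \<subseteq> span C" "card C = dim V" by (rule fin_dim_basis[OF assms(1)])
  then show ?thesis using dim_le_card[of W C] assms(2) by simp
qed

lemma subspace_eq_of_dim_le:
  assumes "fin_dim V" "subspace W" "W \<subseteq> V" "dim V \<le> dim W"
  shows "W = V"
proof -
  obtain B where B: "B \<subseteq> W" "finite B" "independent B" "W \<subseteq> span B" "card B = dim W"
    by (rule fin_dim_basis[OF fin_dim_subset[OF assms(1,3)]])
  obtain C where C: "B \<subseteq> C" "finite C" "V \<subseteq> span C" "card C = dim V"
    by (rule fin_dim_extend_basis[OF assms(1) _ B(3)]) (use B assms(3) in auto)
  have "B = C" using card_seteq[of C B] B C assms(4) by simp
  then show ?thesis using C B assms span_minimal[OF B(1) assms(2)] by blast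
qed

lemma dim_0_iff: 
  assumes "fin_dim V" "subspace V" shows "dim V = 0 \<longleftrightarrow> V = {0}"
proof
  assume "dim V = 0"
  obtain C where "finite C" "V \<subseteq> span C" "card C = dim V" by (rule fin_dim_basis[OF assms(1)])
  with \<open>dim V = 0\<close> show "V = {0}" using assms(2) by (auto simp: subspace_0)
next
  assume "V = {0}" then show "dim V = 0" using dim_le_card[of V "{}"] by simp
qed

lemma dim_span_le_plus:
  assumes "fin_dim A" "fin_dim B" shows "dim (span (A \<union> B)) \<le> dim A + dim B"
proof -
  obtain C where C: "finite C" "A \<subseteq> span C" "card C = dim A" by (rule fin_dim_basis[OF assms(1)])
  obtain D where D: "finite D" "B \<subseteq> span D" "card D = dim B" by (rule fin_dim_basis[OF assms(2)])
  have "A \<union> B \<subseteq> span (C \<union> D)"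
    using C D span_mono[of C "C \<union> D"] span_mono[of D "C \<union> D"] by blast
  then have "dim (A \<union> B) \<le> card (C \<union> D)" using C D by (intro dim_le_card) auto
  then show ?thesis using card_Un_le[of C D] C D by simp
qed

lemma kernel_subspace:
  assumes "operator f" "subspace U"
  shows "subspace {x\<in>U. f x = 0}"
  using endo.linear_subspace_kernel[OF assms(1)] assms(2) subspace_inter
  by (simp add: Collect_conj_eq)

lemma rank_nullity:
  assumes f: "operator f" and U: "subspace U" and fd: "fin_dim U"
  shows "dim (f ` U) + dim {x\<in>U. f x = 0} = dim U"
proof -
  interpret f: Vector_Spaces.linear scale scale f by (rule f)
  let ?K = "{x\<in>U. f x = 0}"
  have sK: "subspace ?K" using kernel_subspace[OF f U] .
  obtain B where B: "B \<subseteq> ?K" "finite B" "independent B" "?K \<subseteq> span B" "card B = dim ?K"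
    by (rule fin_dim_basis[OF fin_dim_subset[OF fd, of ?K]]) auto
  obtain C where C: "B \<subseteq> C" "C \<subseteq> U" "finite C" "independent C" "U \<subseteq> span C" "card C = dim U"
    by (rule fin_dim_extend_basis[OF fd _ B(3)]) (use B in auto)
  let ?D = "C - B"
  have iD: "independent ?D" using C independent_mono by blast
  have "inj_on f (span ?D)"
  proof (subst f.inj_on_iff_eq_0[OF subspace_span], safe)
    fix x assume x: "x \<in> span ?D" "f x = 0"
    have "x \<in> U" using x span_minimal[of ?D U] C U by auto
    then have "x \<in> span B" using x B by auto
    have 0: "representation C x = representation ?D x"
      by (rule representation_extend[OF C(4) x(1)]) auto
    have 1: "representation C x = representation B x"
      by (rule representation_extend[OF C(4) \<open>x \<in> span B\<close> C(1)])
    have "representation C x b = 0" for b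
      using representation_ne_zero[of B x b] representation_ne_zero[of ?D x b] 0 1 by auto
    then show "x = 0"
      using sum_nonzero_representation_eq[OF C(4), of x] \<open>x \<in> U\<close> C(5) by auto
  qed
  then have iF: "independent (f ` ?D)" "inj_on f ?D"
    using f.independent_injective_image[OF iD] inj_on_subset[of f "span ?D" ?D] span_superset[of ?D]
    by auto
  have "f ` U \<subseteq> span (f ` ?D)"
  proof -
    have "f b \<in> span (f ` ?D)" if "b \<in> C" for b
    proof (cases "b \<in> B")
      case True
      then have "f b = 0" using B(1) by blast
      then show ?thesis by (simp add: span_zero)
    qed (use that in \<open>auto intro: span_base\<close>)
    then have "span (f ` C) \<subseteq> span (f ` ?D)" by (intro span_minimal subspace_span) auto
    then show ?thesis using C(5) f.span_image[of C] by blast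
  qed
  moreover have "f ` ?D \<subseteq> f ` U" using C by auto
  ultimately have "card (f ` ?D) = dim (f ` U)" using iF basis_card_eq_dim by blast
  then have "dim (f ` U) = card C - card B" using card_image[OF iF(2)] card_Diff_subset[OF B(2) C(1)] by simp
  moreover have "card B \<le> card C" using C card_mono by blast
  ultimately show ?thesis using B C by simp
qed

text \<open>
  The image of \<open>M\<close> under such a \<open>\<pi>\<close> is a complement of \<open>N\<close> in \<open>M\<close>. It serves as a model of the quotient
  \<open>M / N\<close>, with \<open>\<pi>\<close> as the quotient map.
\<close>

lemma complement_projection:
  assumes N: "subspace N" and M: "subspace M" and NM: "N \<subseteq> M" and fd: "fin_dim M"
  obtains \<pi> where "operator \<pi>" "\<And>x. x \<in> N \<Longrightarrow> \<pi> x = 0"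
    "\<And>x. x \<in> M \<Longrightarrow> \<pi> x \<in> M" "\<And>x. x \<in> M \<Longrightarrow> x - \<pi> x \<in> N" "\<And>x. x \<in> M \<Longrightarrow> \<pi> (\<pi> x) = \<pi> x"
proof -
  obtain B where B: "B \<subseteq> N" "finite B" "independent B" "N \<subseteq> span B"
    by (rule fin_dim_basis[OF fin_dim_subset[OF fd NM]])
  obtain C where C: "B \<subseteq> C" "C \<subseteq> M" "finite C" "independent C" "M \<subseteq> span C"
    by (rule fin_dim_extend_basis[OF fd _ B(3)]) (use B NM in auto)
  define \<pi> where "\<pi> = endo.construct C (\<lambda>b. if b \<in> B then 0 else b)"
  have lin: "operator \<pi>" unfolding \<pi>_def by (rule endo.linear_construct[OF C(4)])
  interpret pi: Vector_Spaces.linear scale scale \<pi> by (rule lin)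
  have \<pi>: "\<pi> b = (if b \<in> B then 0 else b)" if "b \<in> C" for b
    using that unfolding \<pi>_def by (simp add: endo.construct_basis[OF C(4)])
  have zero: "\<pi> x = 0" if "x \<in> N" for x
    by (rule pi.eq_0_on_span[of B x]) (use \<pi> C(1) B(4) that in auto)
  have "\<pi> x \<in> M \<and> x - \<pi> x \<in> N \<and> \<pi> (\<pi> x) = \<pi> x" if "x \<in> span C" for x
    using that
  proof (induction rule: span_induct_alt)
    case base
    then show ?case using M N by (auto simp: subspace_0 pi.zero)
  next
    case (step c x y)
    have x: "\<pi> x \<in> M" "x - \<pi> x \<in> N" "\<pi> (\<pi> x) = \<pi> x"
      using step(1) \<pi>[of x] B(1) C NM N by (auto simp: subspace_0 pi.zero M split: if_splits)
    have "(c *s x + y) - \<pi> (c *s x + y) = c *s (x - \<pi> x) + (y - \<pi> y)"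
      by (simp add: pi.add pi.scale algebra_simps)
    then have "(c *s x + y) - \<pi> (c *s x + y) \<in> N"
      using step(2) x N by (metis subspace_add subspace_scale)
    then show ?case using step x M
      by (simp add: pi.add pi.scale subspace_add subspace_scale)
  qed
  then show ?thesis using that[of \<pi>] lin zero C(5) by blast
qed

text \<open>
  A projection along \<open>A\<close> is injective on \<open>B\<close>, so rank and nullity of it on the sum are the dimensions
  of \<open>B\<close> and \<open>A\<close>.
\<close>

lemma dim_direct_sum:
  assumes A: "subspace A" "fin_dim A" and B: "subspace B" "fin_dim B" and AB: "A \<inter> B \<subseteq> {0}"
  shows "dim (span (A \<union> B)) = dim A + dim B"
proof -
  let ?M = "span (A \<union> B)"
  have fM: "fin_dim ?M" using fin_dim_span_Un A B by blast
  have AM: "A \<subseteq> ?M" "B \<subseteq> ?M" using span_superset[of "A \<union> B"] by auto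
  obtain \<pi> where p: "operator \<pi>" "\<And>x. x \<in> A \<Longrightarrow> \<pi> x = 0" "\<And>x. x \<in> ?M \<Longrightarrow> x - \<pi> x \<in> A"
    by (rule complement_projection[OF A(1) subspace_span AM(1) fM]) simp
  interpret pi: Vector_Spaces.linear scale scale \<pi> by (rule p(1))
  have ker: "x \<in> A" if "x \<in> ?M" "\<pi> x = 0" for x using p(3)[OF that(1)] that(2) by simp
  have "{x \<in> ?M. \<pi> x = 0} = A" using ker p(2) AM by auto
  moreover have "\<pi> ` ?M = \<pi> ` B"
  proof
    show "\<pi> ` ?M \<subseteq> \<pi> ` B"
      using A B p(2) by (auto simp: span_Un pi.add span_eq_iff[THEN iffD2])
  qed (use AM in auto)
  moreover have "{x \<in> B. \<pi> x = 0} = {0}"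
    using ker AM AB B by (auto simp: subspace_0 pi.zero)
  ultimately show ?thesis
    using rank_nullity[OF p(1) subspace_span fM] rank_nullity[OF p(1) B] dim_0_iff[of "{0}"]
      fin_dim_subset[OF B(2), of "{0}"] B(1) by (simp add: subspace_0 subspace_single_0)
qed

lemma avoid_two_subspaces:
  assumes "subspace U" "subspace P" "subspace Q" "\<not> U \<subseteq> P" "\<not> U \<subseteq> Q"
  obtains u where "u \<in> U" "u \<notin> P" "u \<notin> Q"
proof -
  obtain p q where pq: "p \<in> U" "p \<notin> P" "q \<in> U" "q \<notin> Q" using assms by blast
  show ?thesis
  proof (cases "p \<in> Q \<and> q \<in> P")
    case False then show ?thesis using pq that by blast
  next
    case True
    have "p + q \<in> U" using pq assms by (simp add: subspace_add)
    moreover have "p + q \<notin> P" using True pq(2) subspace_diff[OF assms(2), of "p + q" q] by auto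
    moreover have "p + q \<notin> Q" using True pq(4) subspace_diff[OF assms(3), of "p + q" p] by auto
    ultimately show ?thesis using that by blast
  qed
qed

end

section \<open>Eigenvalues\<close>

context operator_space
begin

definition poly_apply :: "'a poly \<Rightarrow> ('b \<Rightarrow> 'b) \<Rightarrow> 'b \<Rightarrow> 'b" where
  "poly_apply p H u = (\<Sum>i\<le>degree p. coeff p i *s (H ^^ i) u)"

lemma poly_apply_eq:
  "degree p \<le> N \<Longrightarrow> poly_apply p H u = (\<Sum>i\<le>N. coeff p i *s (H ^^ i) u)"
  unfolding poly_apply_def by (rule sum.mono_neutral_left) (auto simp: coeff_eq_0)

lemma poly_apply_linear_factor:
  assumes "operator H"
  shows "poly_apply ([:- l, 1:] * q) H u = H (poly_apply q H u) - l *s poly_apply q H u"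
proof -
  interpret H: Vector_Spaces.linear scale scale H by (rule assms)
  define N where "N = degree q"
  have "degree ([:- l, 1:] * q) \<le> Suc N"
    using degree_mult_le[of "[:- l, 1:]" q] unfolding N_def by simp
  then have "poly_apply ([:- l, 1:] * q) H u =
      (\<Sum>i\<le>Suc N. (coeff (pCons 0 q) i - l * coeff q i) *s (H ^^ i) u)"
    by (simp add: poly_apply_eq algebra_simps del: sum.atMost_Suc)
  also have "\<dots> = (\<Sum>i\<le>Suc N. coeff (pCons 0 q) i *s (H ^^ i) u) - (\<Sum>i\<le>Suc N. (l * coeff q i) *s (H ^^ i) u)"
    by (simp add: scale_left_diff_distrib sum_subtractf del: sum.atMost_Suc)
  also have "(\<Sum>i\<le>Suc N. coeff (pCons 0 q) i *s (H ^^ i) u) = H (poly_apply q H u)"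
    by (subst sum.atMost_Suc_shift) (simp add: poly_apply_eq[of q N] N_def H.sum H.scale)
  also have "(\<Sum>i\<le>Suc N. (l * coeff q i) *s (H ^^ i) u) = l *s poly_apply q H u"
    by (simp add: poly_apply_eq[of q "Suc N"] N_def scale_sum_right del: sum.atMost_Suc)
  finally show ?thesis .
qed

text \<open>
  The vectors \<open>u, H u, H\<^sup>2 u, \<dots>\<close> up to the power \<open>dim U\<close> are too many to be independent. If two of these
  powers give the same vector, the polynomial is a difference of monomials; otherwise the coefficients
  of a linear dependence are used.
\<close>

lemma annihilating_poly:
  assumes H: "operator H" and fd: "fin_dim U" and inv: "\<And>x. x \<in> U \<Longrightarrow> H x \<in> U" and u: "u \<in> U"
  obtains p where "p \<noteq> 0" "poly_apply p H u = 0"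
proof -
  define n where "n = dim U"
  have pow: "(H ^^ i) u \<in> U" for i by (induction i) (use u inv in auto)
  show ?thesis
  proof (cases "inj_on (\<lambda>i. (H ^^ i) u) {..n}")
    case False
    then obtain i j where ij: "i \<noteq> j" "(H ^^ i) u = (H ^^ j) u" unfolding inj_on_def by blast
    define p :: "'a poly" where "p = monom 1 i - monom 1 j"
    have "coeff p i = 1" using ij by (simp add: p_def)
    then have p0: "p \<noteq> 0" by auto
    have "degree p \<le> max i j" unfolding p_def by (intro degree_diff_le) (auto simp: degree_monom_le[THEN order_trans])
    then have "poly_apply p H u = (\<Sum>k\<le>max i j. (if k = i then (H ^^ k) u else 0) - (if k = j then (H ^^ k) u else 0))"
      unfolding poly_apply_eq[OF \<open>degree p \<le> max i j\<close>]
      by (intro sum.cong) (auto simp: p_def scale_left_diff_distrib)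
    also have "\<dots> = 0" by (simp add: sum_subtractf ij)
    finally show ?thesis using that p0 by blast
  next
    case True
    let ?B = "(\<lambda>i. (H ^^ i) u) ` {..n}"
    have "card ?B = Suc n" using card_image[OF True] by simp
    moreover obtain C where "finite C" "U \<subseteq> span C" "card C = dim U" by (rule fin_dim_basis[OF fd])
    ultimately have "\<not> independent ?B"
      using independent_span_bound[of C ?B] pow unfolding n_def by fastforce
    then obtain f b where f: "(\<Sum>x\<in>?B. f x *s x) = 0" "b \<in> ?B" "f b \<noteq> 0"
      using independent_if_scalars_zero[of ?B] by blast
    define p :: "'a poly" where "p = Abs_poly (\<lambda>i. if i \<le> n then f ((H ^^ i) u) else 0)"
    have c: "coeff p i = (if i \<le> n then f ((H ^^ i) u) else 0)" for i
      unfolding p_def by (subst coeff_Abs_poly[of n]) auto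
    have "p \<noteq> 0" using f(2,3) c by (metis (no_types, lifting) coeff_0 image_iff atMost_iff)
    moreover have "degree p \<le> n" by (rule degree_le) (simp add: c)
    then have "poly_apply p H u = (\<Sum>i\<le>n. f ((H ^^ i) u) *s (H ^^ i) u)"
      by (simp add: poly_apply_eq c)
    then have "poly_apply p H u = 0" using f(1) sum.reindex[OF True, of "\<lambda>x. f x *s x"] by simp
    ultimately show ?thesis using that by blast
  qed
qed

text \<open>
  Let \<open>p\<close> be nonzero of least degree with \<open>p(H) u = 0\<close> and let \<open>l\<close> be a root of \<open>p\<close>. If \<open>p = (x - l) q\<close>, then
  \<open>q(H) u\<close> is nonzero by minimality, and it is an eigenvector for \<open>l\<close>.
\<close>

lemma eigenvalue_exists:
  assumes H: "operator H" and U: "subspace U" "fin_dim U" "U \<noteq> {0}" and inv: "\<And>x. x \<in> U \<Longrightarrow> H x \<in> U"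
  obtains l u where "u \<in> U" "u \<noteq> 0" "H u = l *s u"
proof -
  obtain u where u: "u \<in> U" "u \<noteq> 0" using U subspace_0 by blast
  define P where "P p \<longleftrightarrow> p \<noteq> 0 \<and> poly_apply p H u = 0" for p
  obtain p0 where p0: "P p0" unfolding P_def by (rule annihilating_poly[OF H U(2) inv u(1)]) auto
  obtain p where p: "P p" "\<And>q. degree q < degree p \<Longrightarrow> \<not> P q"
  proof -
    obtain p where "P p" "\<forall>q. P q \<longrightarrow> degree p \<le> degree q"
      using ex_has_least_nat[of P p0 degree, OF p0] by auto
    then show ?thesis using that[of p] not_less by auto
  qed
  have "degree p \<noteq> 0"
  proof
    assume "degree p = 0"
    moreover have "coeff p (degree p) \<noteq> 0" using p(1) by (simp add: P_def)
    ultimately have "poly_apply p H u = coeff p 0 *s u" "coeff p 0 \<noteq> 0"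
      unfolding poly_apply_def by simp_all
    then show False using p(1) u unfolding P_def by simp
  qed
  then obtain l where "poly p l = 0" using alg_closed_imp_poly_has_root[of p] by auto
  then obtain q where q: "p = [:- l, 1:] * q" using poly_eq_0_iff_dvd[of p l] by (auto elim: dvdE)
  have "q \<noteq> 0"
  proof
    assume "q = 0" then have "p = 0" using q by simp
    then show False using p(1) by (simp add: P_def)
  qed
  then have "degree p = Suc (degree q)" unfolding q by (subst degree_mult_eq) auto
  then have "poly_apply q H u \<noteq> 0" using p(2)[of q] \<open>q \<noteq> 0\<close> by (simp add: P_def)
  moreover have "H (poly_apply q H u) = l *s poly_apply q H u"
    using p(1) poly_apply_linear_factor[OF H, of l q u] unfolding P_def q[symmetric] by simp
  moreover have "poly_apply q H u \<in> U"
  proof -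
    have "(H ^^ i) u \<in> U" for i by (induction i) (use u inv in auto)
    then show ?thesis unfolding poly_apply_def using U by (intro subspace_sum subspace_scale) auto
  qed
  ultimately show ?thesis using that[of "poly_apply q H u" l] by simp
qed

end

section \<open>Transversal subspaces and products of shifts\<close>

context operator_space
begin

lemma dim_span_insert:
  assumes "subspace Z" "fin_dim Z" "u \<notin> Z" shows "dim (span (insert u Z)) = dim Z + 1"
proof -
  obtain C where C: "C \<subseteq> Z" "finite C" "independent C" "Z \<subseteq> span C" "card C = dim Z"
    by (rule fin_dim_basis[OF assms(2)])
  have "span C = Z" using C(1,4) span_minimal[OF C(1) assms(1)] by simp
  then have "u \<notin> span C" "u \<notin> C" using assms(3) C(1) by auto
  then have "independent (insert u C)" using C(3) by (intro independent_insertI)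
  moreover have "span (insert u C) = span (insert u Z)"
    using \<open>span C = Z\<close> span_superset[of C] by (auto simp: span_breakdown_eq span_span)
  moreover have "dim (span (insert u C)) = card (insert u C)"
    by (rule dim_span_eq_card_independent[OF \<open>independent (insert u C)\<close>])
  ultimately show ?thesis using C \<open>u \<notin> C\<close> by simp
qed

lemma span_insertE:
  assumes "x \<in> span (insert u Z)" "subspace Z"
  obtains k z where "z \<in> Z" "x = k *s u + z"
proof -
  obtain k where "x - k *s u \<in> span Z" using assms(1) span_breakdown_eq by blast
  then have "x - k *s u \<in> Z" using assms(2) by (simp add: span_eq_iff[THEN iffD2])
  then show ?thesis using that[of "x - k *s u" k] by simp
qed

lemma cancel_scale_mem:
  assumes "subspace T" "k *s u \<in> T" "k \<noteq> 0" shows "u \<in> T"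
  using subspace_scale[OF assms(1,2), of "inverse k"] assms(3) by simp

text \<open>
  The step of the greedy constructions below: a subspace that meets \<open>K\<close> trivially can be enlarged
  by any vector outside its sum with \<open>K\<close>.
\<close>

lemma insert_avoids:
  assumes "subspace Z" "subspace K" "Z \<inter> K \<subseteq> {0}" "u \<notin> span (Z \<union> K)"
  shows "span (insert u Z) \<inter> K \<subseteq> {0}"
proof
  fix x assume x: "x \<in> span (insert u Z) \<inter> K"
  then obtain k z where kz: "z \<in> Z" "x = k *s u + z" by (blast elim: span_insertE[OF _ assms(1)])
  have "k = 0"
  proof (rule ccontr)
    assume "k \<noteq> 0"
    have "x - z \<in> span (Z \<union> K)" using x kz by (intro span_diff span_base) auto
    then have "k *s u \<in> span (Z \<union> K)" using kz by simp
    then show False using cancel_scale_mem[OF subspace_span] \<open>k \<noteq> 0\<close> assms(4) by blast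
  qed
  then show "x \<in> {0}" using x kz assms(3) by auto
qed

text \<open>
  Transversality of \<open>Z\<close> says that \<open>H\<close> induces an injective map from \<open>Z\<close> to the quotient by \<open>Z\<close>. It is not
  affected by adding a scalar to \<open>H\<close>, which is why it measures how far \<open>H\<close> is from being scalar.
\<close>

definition transversal :: "('b \<Rightarrow> 'b) \<Rightarrow> 'b set \<Rightarrow> bool" where
  "transversal H Z \<longleftrightarrow> subspace Z \<and> (\<forall>z\<in>Z. H z \<in> Z \<longrightarrow> z = 0)"

abbreviation shift :: "('b \<Rightarrow> 'b) \<Rightarrow> 'a \<Rightarrow> 'b \<Rightarrow> 'b" where
  "shift H l \<equiv> \<lambda>x. H x - l *s x"

lemma operator_shift: "operator H \<Longrightarrow> operator (shift H l)"
  by (intro endo.linear_compose_sub linear_scale_self)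

lemma transversal_shift: "transversal (shift H l) Z \<Longrightarrow> transversal H Z"
  unfolding transversal_def by (auto simp: subspace_scale subspace_diff)

text \<open>
  If \<open>Z\<close> meets both the kernel and the image of \<open>Y\<close> trivially, then it is transversal, because
  \<open>Y z \<in> Z\<close> gives first \<open>Y z = 0\<close> and then \<open>z = 0\<close>. Such a \<open>Z\<close> is built one dimension at a time: as long as
  its dimension is below the rank of \<open>Y\<close>, its sums with the kernel and with the image are proper
  subspaces, and a space is not the union of two proper subspaces.
\<close>

lemma transversal_of_small_rank:
  assumes Y: "operator Y" and U: "subspace U" "fin_dim U" and inv: "\<And>x. x \<in> U \<Longrightarrow> Y x \<in> U"
    and le: "dim (Y ` U) \<le> dim {x\<in>U. Y x = 0}"
  obtains Z where "transversal Y Z" "Z \<subseteq> U" "dim Z = dim (Y ` U)"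
proof -
  let ?K = "{x\<in>U. Y x = 0}" and ?I = "Y ` U"
  have sK: "subspace ?K" and sI: "subspace ?I"
    using kernel_subspace[OF Y U(1)] endo.linear_subspace_image[OF Y U(1)] by auto
  have "?K \<subseteq> U" "?I \<subseteq> U" using inv by auto
  then have fdK: "fin_dim ?K" and fdI: "fin_dim ?I" using fin_dim_subset[OF U(2)] by blast+
  have rn: "dim ?I + dim ?K = dim U" by (rule rank_nullity[OF Y U])
  have "h \<le> dim ?I \<Longrightarrow> \<exists>Z. subspace Z \<and> Z \<subseteq> U \<and> dim Z = h \<and> Z \<inter> ?K \<subseteq> {0} \<and> Z \<inter> ?I \<subseteq> {0}" for h
  proof (induction h)
    case 0
    have "fin_dim {0}" using fin_dim_subset[OF U(2), of "{0}"] U(1) by (simp add: subspace_0)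
    then show ?case using dim_0_iff[of "{0}"] U(1)
      by (intro exI[of _ "{0}"]) (auto simp: subspace_single_0 subspace_0)
  next
    case (Suc h)
    then obtain Z where Z: "subspace Z" "Z \<subseteq> U" "dim Z = h" "Z \<inter> ?K \<subseteq> {0}" "Z \<inter> ?I \<subseteq> {0}" by auto
    have fdZ: "fin_dim Z" using fin_dim_subset[OF U(2) Z(2)] .
    have "\<not> U \<subseteq> span (Z \<union> ?K)"
      using dim_mono_fin_dim[OF fin_dim_span_Un[OF fdZ fdK], of U] dim_span_le_plus[OF fdZ fdK] Z(3) Suc(2) rn by auto
    moreover have "\<not> U \<subseteq> span (Z \<union> ?I)"
      using dim_mono_fin_dim[OF fin_dim_span_Un[OF fdZ fdI], of U] dim_span_le_plus[OF fdZ fdI] Z(3) Suc(2) rn le by auto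
    ultimately obtain u where u: "u \<in> U" "u \<notin> span (Z \<union> ?K)" "u \<notin> span (Z \<union> ?I)"
      by (rule avoid_two_subspaces[OF U(1) subspace_span subspace_span])
    have "u \<notin> Z" using u(2) by (auto intro: span_base)
    then have "dim (span (insert u Z)) = Suc h" using dim_span_insert[OF Z(1) fdZ] Z(3) by simp
    moreover have "span (insert u Z) \<subseteq> U" using u(1) Z(2) by (intro span_minimal U) auto
    ultimately show ?case
      using insert_avoids[OF Z(1) sK Z(4) u(2)] insert_avoids[OF Z(1) sI Z(5) u(3)]
      by (intro exI[of _ "span (insert u Z)"]) auto
  qed
  from this[of "dim ?I"] obtain Z where Z: "subspace Z" "Z \<subseteq> U" "dim Z = dim ?I" 
    "Z \<inter> ?K \<subseteq> {0}" "Z \<inter> ?I \<subseteq> {0}" by auto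
  have "transversal Y Z" unfolding transversal_def
  proof (intro conjI ballI impI Z(1))
    fix z assume z: "z \<in> Z" "Y z \<in> Z"
    then have "Y z = 0" using Z(2,5) by auto
    then show "z = 0" using z Z(2,4) by auto
  qed
  then show ?thesis using that Z by blast
qed

text \<open>
  Every vector outside \<open>T\<close> is an eigenvector of \<open>H\<close> modulo \<open>T\<close>. Two vectors that are independent modulo
  \<open>T\<close> have the same eigenvalue, since their sum is an eigenvector as well. As \<open>T\<close> has codimension at
  least two, every vector, also one in \<open>T\<close>, is a difference of two vectors that are independent
  of a fixed \<open>v\<close> modulo \<open>T\<close>.
\<close>

lemma scalar_modulo_subspace:
  assumes H: "operator H" and U: "subspace U" "fin_dim U" and inv: "\<And>x. x \<in> U \<Longrightarrow> H x \<in> U"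
    and T: "subspace T" "T \<subseteq> U" "dim T + 2 \<le> dim U"
    and eig: "\<And>u. u \<in> U \<Longrightarrow> u \<notin> T \<Longrightarrow> H u \<in> span (insert u T)"
  obtains l where "\<And>u. u \<in> U \<Longrightarrow> shift H l u \<in> T"
proof -
  interpret H: Vector_Spaces.linear scale scale H by (rule H)
  have fdT: "fin_dim T" using fin_dim_subset[OF U(2) T(2)] .
  have eig': "\<exists>a. H u - a *s u \<in> T" if "u \<in> U" "u \<notin> T" for u
    using span_insertE[OF eig[OF that] T(1)] by (metis add_diff_cancel_left')
  have "T \<noteq> U" using T(3) by auto
  then obtain v where v: "v \<in> U" "v \<notin> T" using T(2) by blast
  obtain l where l: "H v - l *s v \<in> T" using eig'[OF v] by blast
  let ?T = "span (insert v T)"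
  have "dim ?T < dim U" using dim_span_insert[OF T(1) fdT v(2)] T(3) by simp
  then have "\<not> U \<subseteq> ?T" using dim_mono_fin_dim[of ?T U] fin_dim_span_Un[OF _ fdT, of "{v}"]
    fin_dim_subset[OF U(2), of "{v}"] v(1) by auto
  then obtain w where w: "w \<in> U" "w \<notin> ?T" by blast
  have T': "T \<subseteq> ?T" "v \<in> ?T" by (auto intro: span_base)
  have out: "shift H l u \<in> T" if u: "u \<in> U" "u \<notin> ?T" for u
  proof -
    have "u \<notin> T" using u(2) T' by blast
    then obtain a where a: "H u - a *s u \<in> T" using eig' u(1) by blast
    have "u + v \<notin> T"
      using subspace_diff[OF subspace_span, of "u + v" "insert v T" v] T' u(2) by auto
    moreover have "u + v \<in> U" using u v U by (simp add: subspace_add)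
    ultimately obtain b where b: "H (u + v) - b *s (u + v) \<in> T" using eig' by blast
    have "(H (u + v) - b *s (u + v)) - (H u - a *s u) - (H v - l *s v) \<in> T"
      using a b l T(1) by (simp add: subspace_diff)
    then have *: "(a - b) *s u + (l - b) *s v \<in> T" by (simp add: H.add algebra_simps)
    have "a = b"
    proof (rule ccontr)
      assume "a \<noteq> b"
      have "((a - b) *s u + (l - b) *s v) - (l - b) *s v \<in> ?T"
        using * T' by (intro span_diff span_scale) auto
      then show False using cancel_scale_mem[OF subspace_span, of "a - b" u "insert v T"] \<open>a \<noteq> b\<close> u(2) by simp
    qed
    then have "l = b" using cancel_scale_mem[OF T(1), of "l - b" v] * v(2) by auto
    then show ?thesis using a \<open>a = b\<close> by simp
  qed
  have "shift H l u \<in> T" if u: "u \<in> U" for u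
  proof (cases "u \<in> ?T")
    case True
    have "u + w \<notin> ?T" using subspace_diff[OF subspace_span, of "u + w" "insert v T" u] True w(2) by auto
    moreover have "u + w \<in> U" using u w U by (simp add: subspace_add)
    ultimately have "shift H l (u + w) - shift H l w \<in> T"
      using out w T(1) by (blast intro: subspace_diff)
    then show ?thesis by (simp add: H.add algebra_simps)
  qed (use out u in auto)
  then show ?thesis using that by blast
qed

text \<open>
  Let \<open>Z\<close> be a transversal subspace of maximal dimension and \<open>T = Z + H Z\<close>, of dimension at most
  \<open>2 dim Z\<close>. A vector \<open>u\<close> outside \<open>T\<close> with \<open>H u\<close> outside \<open>T + K u\<close> could be added to \<open>Z\<close>. If there is
  none and \<open>2 dim Z < r\<close>, then \<open>H\<close> is a scalar \<open>l\<close> modulo \<open>T\<close>, and the rank of \<open>H - l\<close> is at most the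
  dimension of \<open>T\<close>, hence less than \<open>r\<close>.
\<close>

lemma transversal_of_rank_bound:
  assumes H: "operator H" and U: "subspace U" "fin_dim U" and inv: "\<And>x. x \<in> U \<Longrightarrow> H x \<in> U"
    and rk: "\<And>l. r \<le> dim (shift H l ` U)" and r: "r < dim U"
  obtains Z where "transversal H Z" "Z \<subseteq> U" "r \<le> 2 * dim Z"
proof -
  interpret H: Vector_Spaces.linear scale scale H by (rule H)
  define P where "P Z \<longleftrightarrow> transversal H Z \<and> Z \<subseteq> U" for Z
  have "P {0}" using U(1) by (simp add: P_def transversal_def subspace_single_0 subspace_0)
  moreover have "\<forall>Z. P Z \<longrightarrow> dim Z < Suc (dim U)"
    using dim_mono_fin_dim[OF U(2)] by (auto simp: P_def less_Suc_eq_le)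
  ultimately obtain Z where Z: "P Z" "\<And>Z'. P Z' \<Longrightarrow> dim Z' \<le> dim Z"
  proof -
    assume a: "P {0}" "\<forall>Z. P Z \<longrightarrow> dim Z < Suc (dim U)"
    show ?thesis using ex_has_greatest_nat[OF a] that by blast
  qed
  have sZ: "subspace Z" "Z \<subseteq> U" "\<And>z. z \<in> Z \<Longrightarrow> H z \<in> Z \<Longrightarrow> z = 0"
    using Z(1) by (auto simp: P_def transversal_def)
  have fdZ: "fin_dim Z" using fin_dim_subset[OF U(2) sZ(2)] .
  have "r \<le> 2 * dim Z"
  proof (rule ccontr)
    assume less: "\<not> r \<le> 2 * dim Z"
    let ?T = "span (Z \<union> H ` Z)"
    have "H ` Z \<subseteq> U" using inv sZ(2) by auto
    then have HZ: "fin_dim (H ` Z)" by (rule fin_dim_subset[OF U(2)])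
    have dT: "dim ?T \<le> 2 * dim Z"
      using dim_span_le_plus[OF fdZ HZ] rank_nullity[OF H sZ(1) fdZ] by simp
    have TU: "?T \<subseteq> U" using sZ(2) inv by (intro span_minimal U) auto
    have "\<exists>u\<in>U. u \<notin> ?T \<and> H u \<notin> span (insert u ?T)"
    proof (rule ccontr)
      assume "\<not> ?thesis"
      then have all: "H u \<in> span (insert u ?T)" if "u \<in> U" "u \<notin> ?T" for u
        using that by blast
      have "dim ?T + 2 \<le> dim U" using dT less r by simp
      then obtain l where l: "\<And>u. u \<in> U \<Longrightarrow> shift H l u \<in> ?T"
        using scalar_modulo_subspace[OF H U inv subspace_span TU _ all] by blast
      have "shift H l ` U \<subseteq> ?T" using l by (rule image_subsetI)
      then have "dim (shift H l ` U) \<le> dim ?T"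
        by (rule dim_mono_fin_dim[OF fin_dim_span_Un[OF fdZ HZ]])
      then show False using rk[of l] dT less by simp
    qed
    then obtain u where u: "u \<in> U" "u \<notin> ?T" "H u \<notin> span (insert u ?T)" by blast
    let ?Z = "span (insert u Z)"
    have "x = 0" if x: "x \<in> ?Z" "H x \<in> ?Z" for x
    proof -
      obtain k z where z: "z \<in> Z" "x = k *s u + z" using span_insertE[OF x(1) sZ(1)] by blast
      obtain k' z' where z': "z' \<in> Z" "H x = k' *s u + z'" using span_insertE[OF x(2) sZ(1)] by blast
      have mem: "z \<in> ?T" "H z \<in> ?T" "z' \<in> ?T" using z z' by (auto intro: span_base)
      have eq: "k *s H u = k' *s u + (z' - H z)" using z z' by (simp add: H.add H.scale algebra_simps)
      have "k = 0"
      proof (rule ccontr)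
        assume "k \<noteq> 0"
        have "k' *s u + (z' - H z) \<in> span (insert u ?T)"
          using mem by (intro span_add span_diff span_scale) (auto intro: span_base)
        then show False using eq u(3) \<open>k \<noteq> 0\<close> cancel_scale_mem[OF subspace_span] by metis
      qed
      then have "k' *s u = H z - z'" using eq by (simp add: algebra_simps)
      then have "k' *s u \<in> ?T" using mem by (simp add: span_diff)
      then have "k' = 0" using cancel_scale_mem[OF subspace_span] u(2) by blast
      then have "H z \<in> Z" using z z' \<open>k = 0\<close> by simp
      then show "x = 0" using sZ(3) z \<open>k = 0\<close> by simp
    qed
    then have "P ?Z" unfolding P_def transversal_def
      using span_minimal[of "insert u Z" U] u(1) sZ(2) U(1) by auto
    moreover have "u \<notin> Z" using u(2) by (auto intro: span_base)
    ultimately show False using Z(2)[of ?Z] dim_span_insert[OF sZ(1) fdZ] by simp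
  qed
  then show ?thesis using that Z(1) by (auto simp: P_def)
qed

text \<open>
  \<open>shift_prod H [l\<^sub>1, \<dots>, l\<^sub>j]\<close> is \<open>(H - l\<^sub>j) \<cdots> (H - l\<^sub>1)\<close>.
\<close>

primrec shift_prod :: "('b \<Rightarrow> 'b) \<Rightarrow> 'a list \<Rightarrow> 'b \<Rightarrow> 'b" where
  "shift_prod H [] x = x"
| "shift_prod H (l # ls) x = shift_prod H ls (shift H l x)"

lemma max_eigenspace:
  assumes "fin_dim U"
  obtains l where "\<And>m. dim {x\<in>U. shift H m x = 0} \<le> dim {x\<in>U. shift H l x = 0}"
proof -
  have "\<forall>l. True \<longrightarrow> dim {x\<in>U. shift H l x = 0} < Suc (dim U)"
    using dim_mono_fin_dim[OF assms] by (auto simp: less_Suc_eq_le)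
  from ex_has_greatest_nat[OF TrueI this] that show ?thesis by blast
qed

text \<open>
  A product of \<open>j\<close> factors of the form \<open>H - l\<close> can have rank between \<open>1\<close> and \<open>dim U / (j + 1)\<close>: replace \<open>U\<close>
  by \<open>(H - l) U\<close>, always with an \<open>l\<close> whose eigenspace in the current space is largest, until \<open>H\<close> is scalar
  on what remains. The last space consists of eigenvectors, and it lies in all the earlier ones.
  So each step loses at least as many dimensions as there are at the end.
\<close>

lemma eigen_product:
  assumes H: "operator H"
  shows "subspace U \<Longrightarrow> fin_dim U \<Longrightarrow> U \<noteq> {0} \<Longrightarrow> (\<And>x. x \<in> U \<Longrightarrow> H x \<in> U) \<Longrightarrow>
    \<exists>ls l. shift_prod H ls ` U \<noteq> {0} \<and> (length ls + 1) * dim (shift_prod H ls ` U) \<le> dim U \<and>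
      shift_prod H ls ` U \<subseteq> U \<and> (\<forall>y\<in>shift_prod H ls ` U. H y = l *s y)"
proof (induction "dim U" arbitrary: U rule: less_induct)
  case less
  obtain l where l: "\<And>m. dim {x\<in>U. shift H m x = 0} \<le> dim {x\<in>U. shift H l x = 0}"
    by (rule max_eigenspace[OF less.prems(2), where H = H]) auto
  let ?K = "\<lambda>m. {x\<in>U. shift H m x = 0}" and ?U = "shift H l ` U"
  have rn: "dim ?U + dim (?K l) = dim U"
    by (rule rank_nullity[OF operator_shift[OF H] less.prems(1,2)])
  obtain m u where u: "u \<in> U" "u \<noteq> 0" "H u = m *s u"
    by (rule eigenvalue_exists[OF H less.prems])
  have K: "fin_dim (?K m)" "subspace (?K m)"
    using kernel_subspace[OF operator_shift[OF H] less.prems(1)] fin_dim_subset[OF less.prems(2)] by auto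
  have "u \<in> ?K m" using u by simp
  then have "dim (?K m) \<noteq> 0" using dim_0_iff[OF K] u(2) by blast
  then have g: "0 < dim (?K l)" using l[of m] by simp
  show ?case
  proof (cases "?U = {0}")
    case True
    have "H x = l *s x" if "x \<in> U" for x
    proof -
      have "shift H l x \<in> ?U" using that by (rule imageI)
      then show ?thesis using True by simp
    qed
    then show ?thesis using less.prems(3) by (intro exI[of _ "[]"] exI[of _ l]) auto
  next
    case False
    have U': "subspace ?U" "?U \<subseteq> U"
      using endo.linear_subspace_image[OF operator_shift[OF H] less.prems(1)] less.prems(1,4)
      by (auto intro: subspace_diff subspace_scale)
    have inv: "H x \<in> ?U" if "x \<in> ?U" for x
    proof -
      interpret H: Vector_Spaces.linear scale scale H by (rule H)
      obtain y where "y \<in> U" "x = shift H l y" using \<open>x \<in> ?U\<close> by blast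
      then have "H x = shift H l (H y)" "H y \<in> U" using less.prems(4) by (simp_all add: H.diff H.scale)
      then show ?thesis by blast
    qed
    have "dim ?U < dim U" using rn g by simp
    obtain ls l' Q where Q: "Q = shift_prod H ls ` ?U" and ls: "Q \<noteq> {0}"
      "(length ls + 1) * dim Q \<le> dim ?U" "Q \<subseteq> ?U" "\<forall>y\<in>Q. H y = l' *s y"
    proof -
      have "\<exists>ls l. shift_prod H ls ` ?U \<noteq> {0} \<and>
          (length ls + 1) * dim (shift_prod H ls ` ?U) \<le> dim ?U \<and>
          shift_prod H ls ` ?U \<subseteq> ?U \<and> (\<forall>y\<in>shift_prod H ls ` ?U. H y = l *s y)"
        by (rule less.hyps[OF \<open>dim ?U < dim U\<close> U'(1) fin_dim_subset[OF less.prems(2) U'(2)] False])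
          (rule inv)
      then show ?thesis by (elim exE conjE) (rule that[OF refl])
    qed
    let ?Q = Q
    have "?Q \<subseteq> ?K l'"
    proof
      fix y assume y: "y \<in> Q"
      then have "y \<in> U" "H y = l' *s y" using ls(3,4) U'(2) by blast+
      then show "y \<in> ?K l'" by simp
    qed
    then have "dim ?Q \<le> dim (?K l)"
      using dim_mono_fin_dim[of "?K l'" ?Q] fin_dim_subset[OF less.prems(2), of "?K l'"] l[of l'] by auto
    then have "(length (l # ls) + 1) * dim ?Q \<le> dim U" using ls(2) rn by simp
    moreover have "shift_prod H (l # ls) ` U = ?Q" unfolding Q by (simp add: image_image)
    moreover have "?Q \<subseteq> U" using ls(3) U'(2) by (rule subset_trans)
    ultimately show ?thesis using ls(1,4)
      by (intro exI[of _ "l # ls"] exI[of _ l']) (simp only: simp_thms)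
  qed
qed

end

section \<open>Spans of words and irreducible actions\<close>

locale word_action = operator_space scale
  for scale :: "'a::alg_closed_field \<Rightarrow> 'b::ab_group_add \<Rightarrow> 'b" (infixr \<open>*s\<close> 75) +
  fixes S :: "'c set" and act :: "'c \<Rightarrow> 'b \<Rightarrow> 'b"
  assumes operator_act: "s \<in> S \<Longrightarrow> operator (act s)"
begin

primrec word :: "'c list \<Rightarrow> 'b \<Rightarrow> 'b" where
  "word [] x = x"
| "word (s # w) x = act s (word w x)"

lemma word_append: "word (u @ w) x = word u (word w x)"
  by (induction u) auto

lemma operator_word: "set w \<subseteq> S \<Longrightarrow> operator (word w)"
proof (induction w)
  case Nil
  then show ?case using linear_id by (simp add: id_def)
next
  case (Cons s w)
  then show ?case
    using Vector_Spaces.linear_compose[of scale scale "word w" scale "act s"] operator_act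
    by (simp add: comp_def)
qed

text \<open>
  The operators in \<open>comb k\<close> are the linear combinations of words of length at most \<open>k\<close>. Adding one
  multiple of a word at a time gives the induction rule from which all closure properties follow.
\<close>

inductive_set comb :: "nat \<Rightarrow> ('b \<Rightarrow> 'b) set" for k where
  comb_zero: "(\<lambda>x. 0) \<in> comb k"
| comb_step: "f \<in> comb k \<Longrightarrow> set w \<subseteq> S \<Longrightarrow> length w \<le> k \<Longrightarrow> (\<lambda>x. c *s word w x + f x) \<in> comb k"

lemma comb_mono: "f \<in> comb j \<Longrightarrow> j \<le> k \<Longrightarrow> f \<in> comb k"
  by (induction rule: comb.induct) (auto intro: comb.intros)

lemma comb_word: "set w \<subseteq> S \<Longrightarrow> length w \<le> k \<Longrightarrow> word w \<in> comb k"
  using comb_step[OF comb_zero, of w k 1] by simp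

lemma comb_id: "(\<lambda>x. x) \<in> comb k"
proof -
  have "word [] = (\<lambda>x. x)" by (simp add: fun_eq_iff)
  then show ?thesis using comb_word[of "[]" k] by simp
qed

lemma comb_add: 
  assumes "f \<in> comb k" "g \<in> comb k" shows "(\<lambda>x. f x + g x) \<in> comb k"
  using assms(1)
proof (induction)
  case (comb_step f w c)
  then show ?case using comb.comb_step[of "\<lambda>x. f x + g x" k w c] by (simp add: add.assoc)
qed (use assms(2) in simp)

lemma comb_scale: "f \<in> comb k \<Longrightarrow> (\<lambda>x. a *s f x) \<in> comb k"
proof (induction rule: comb.induct)
  case (comb_step f w c)
  then show ?case using comb.comb_step[of "\<lambda>x. a *s f x" k w "a * c"] by (simp add: scale_right_distrib)
qed (simp add: comb_zero)

lemma comb_diff: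
  assumes "f \<in> comb k" "g \<in> comb k" shows "(\<lambda>x. f x - g x) \<in> comb k"
  using comb_add[OF assms(1) comb_scale[OF assms(2), of "-1"]] by simp

lemma comb_sum: "(\<And>i. i \<in> I \<Longrightarrow> f i \<in> comb k) \<Longrightarrow> (\<lambda>x. \<Sum>i\<in>I. f i x) \<in> comb k"
  by (induction I rule: infinite_finite_induct) (auto simp: comb_zero intro: comb_add)

lemma comb_operator: "f \<in> comb k \<Longrightarrow> operator f"
proof (induction rule: comb.induct)
  case comb_zero
  then show ?case by (rule endo.linear_zero)
next
  case (comb_step f w c)
  then show ?case using operator_word by (intro endo.linear_compose_add endo.linear_compose_scale_right)
qed

lemma comb_compose:
  assumes f: "f \<in> comb j" and g: "g \<in> comb k"
  shows "(\<lambda>x. f (g x)) \<in> comb (j + k)"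
  using f
proof (induction)
  case comb_zero
  then show ?case by (rule comb.comb_zero)
next
  case (comb_step f u c)
  have "(\<lambda>x. word u (g x)) \<in> comb (j + k)"
    using g
  proof (induction)
    case comb_zero
    interpret u: Vector_Spaces.linear scale scale "word u" using operator_word comb_step by blast
    show ?case by (simp add: u.zero comb.comb_zero)
  next
    case (comb_step g w d)
    interpret u: Vector_Spaces.linear scale scale "word u" using operator_word \<open>set u \<subseteq> S\<close> by blast
    have "(\<lambda>x. d *s word (u @ w) x + word u (g x)) \<in> comb (j + k)"
      using comb_step \<open>set u \<subseteq> S\<close> \<open>length u \<le> j\<close> by (intro comb.comb_step) auto
    then show ?case by (simp add: u.add u.scale word_append)
  qed
  then show ?case using comb_step by (intro comb_add comb_scale)
qed

lemma comb_invariant: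
  assumes "f \<in> comb k" "subspace V" "\<And>s x. s \<in> S \<Longrightarrow> x \<in> V \<Longrightarrow> act s x \<in> V" "x \<in> V"
  shows "f x \<in> V"
  using assms(1)
proof (induction)
  case (comb_step f w c)
  have "word w x \<in> V" using comb_step(2) by (induction w) (use assms in auto)
  then show ?case using comb_step assms by (intro subspace_add subspace_scale)
qed (use assms in \<open>simp add: subspace_0\<close>)

end

locale irreducible_word_action = word_action scale S act
  for scale :: "'a::alg_closed_field \<Rightarrow> 'b::ab_group_add \<Rightarrow> 'b" (infixr \<open>*s\<close> 75)
    and S :: "'c set" and act +
  fixes V :: "'b set"
  assumes subspace_V: "subspace V" and fin_dim_V: "fin_dim V" and V_nonzero: "V \<noteq> {0}"
    and act_V: "s \<in> S \<Longrightarrow> x \<in> V \<Longrightarrow> act s x \<in> V"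
    and irreducible: "subspace W \<Longrightarrow> W \<subseteq> V \<Longrightarrow> (\<And>s x. s \<in> S \<Longrightarrow> x \<in> W \<Longrightarrow> act s x \<in> W) \<Longrightarrow>
      W = {0} \<or> W = V"
begin

abbreviation "n \<equiv> dim V"

lemma n_pos: "0 < n" using dim_0_iff[OF fin_dim_V subspace_V] V_nonzero by simp

lemma comb_V: "f \<in> comb k \<Longrightarrow> x \<in> V \<Longrightarrow> f x \<in> V"
  using comb_invariant[OF _ subspace_V act_V] by blast

lemma word_V: "set w \<subseteq> S \<Longrightarrow> x \<in> V \<Longrightarrow> word w x \<in> V"
  using comb_V[OF comb_word[of w "length w"]] by simp

definition orbit :: "nat \<Rightarrow> 'b \<Rightarrow> 'b set" where
  "orbit j u = (\<lambda>f. f u) ` comb j"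

lemma subspace_orbit: "subspace (orbit j u)"
  unfolding subspace_def orbit_def
proof (intro conjI ballI allI)
  show "0 \<in> (\<lambda>f. f u) ` comb j" using comb_zero by force
next
  fix x y assume "x \<in> (\<lambda>f. f u) ` comb j" "y \<in> (\<lambda>f. f u) ` comb j"
  then obtain f g where "f \<in> comb j" "g \<in> comb j" "x = f u" "y = g u" by blast
  then show "x + y \<in> (\<lambda>f. f u) ` comb j" using comb_add[of f j g] by force
next
  fix c x assume "x \<in> (\<lambda>f. f u) ` comb j"
  then obtain f where "f \<in> comb j" "x = f u" by blast
  then show "c *s x \<in> (\<lambda>f. f u) ` comb j" using comb_scale[of f j c] by force
qed

lemma orbit_mono: "j \<le> k \<Longrightarrow> orbit j u \<subseteq> orbit k u"
  unfolding orbit_def using comb_mono by blast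

lemma act_orbit: "s \<in> S \<Longrightarrow> x \<in> orbit j u \<Longrightarrow> act s x \<in> orbit (Suc j) u"
proof -
  assume s: "s \<in> S" and "x \<in> orbit j u"
  then obtain f where f: "f \<in> comb j" "x = f u" by (auto simp: orbit_def)
  have "(\<lambda>x. word [s] (f x)) \<in> comb (1 + j)" using s f by (intro comb_compose comb_word) auto
  then show "act s x \<in> orbit (Suc j) u" unfolding orbit_def f(2) by (intro image_eqI[of _ _ "\<lambda>x. word [s] (f x)"]) auto
qed

text \<open>
  The subspaces \<open>orbit j u\<close> increase with \<open>j\<close>. When two successive ones coincide, they are invariant and
  therefore all of \<open>V\<close>; until then each step gains a dimension.
\<close>

lemma orbit_eq_V:
  assumes u: "u \<in> V" "u \<noteq> 0" shows "orbit (n - 1) u = V"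
proof -
  have sub: "orbit j u \<subseteq> V" for j using comb_V u(1) by (auto simp: orbit_def)
  have fdo: "fin_dim (orbit j u)" for j using fin_dim_subset[OF fin_dim_V sub] .
  have uo: "u \<in> orbit j u" for j using comb_id by (force simp: orbit_def)
  have "j < n \<Longrightarrow> Suc j \<le> dim (orbit j u)" for j
  proof (induction j)
    case 0
    have "dim (orbit 0 u) \<noteq> 0" using dim_0_iff[OF fdo subspace_orbit] uo[of 0] u(2) by auto
    then show ?case by simp
  next
    case (Suc j)
    then have IH: "Suc j \<le> dim (orbit j u)" by simp
    show ?case
    proof (cases "orbit (Suc j) u \<subseteq> orbit j u")
      case True
      have "orbit j u = {0} \<or> orbit j u = V"
        by (rule irreducible[OF subspace_orbit sub]) (use act_orbit True in blast)
      then have "orbit j u = V" using uo[of j] u(2) by auto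
      then have "orbit (Suc j) u = V" using sub orbit_mono[of j "Suc j" u] by auto
      then show ?thesis using Suc.prems by simp
    next
      case False
      have le: "orbit j u \<subseteq> orbit (Suc j) u" by (rule orbit_mono) simp
      have "\<not> dim (orbit (Suc j) u) \<le> dim (orbit j u)"
        using subspace_eq_of_dim_le[OF fdo subspace_orbit le] False by auto
      then show ?thesis using IH by simp
    qed
  qed
  from this[of "n - 1"] have "n \<le> dim (orbit (n - 1) u)" using n_pos by simp
  then show ?thesis using subspace_eq_of_dim_le[OF fin_dim_V subspace_orbit sub] by blast
qed

end

section \<open>Lowering the rank of a short operator\<close>

context irreducible_word_action
begin

text \<open>
  Otherwise, for any nonzero \<open>u\<close> in the image of \<open>A\<close>, the operator \<open>A\<close> would map the orbit of \<open>u\<close>, which is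
  all of \<open>V\<close>, to the line spanned by \<open>u\<close>.
\<close>

lemma nonscalar_word_exists:
  assumes A: "A \<in> comb k" and r: "2 \<le> dim (A ` V)"
  shows "\<exists>w. set w \<subseteq> S \<and> \<not> (\<exists>c. \<forall>u\<in>A ` V. A (word w u) = c *s u)"
proof (rule ccontr)
  assume "\<not> ?thesis"
  then have sc: "\<exists>c. \<forall>u\<in>A ` V. A (word w u) = c *s u" if "set w \<subseteq> S" for w using that by blast
  interpret A: Vector_Spaces.linear scale scale A by (rule comb_operator[OF A])
  have AV: "A ` V \<subseteq> V" using comb_V[OF A] by auto
  have sAV: "subspace (A ` V)" using endo.linear_subspace_image[OF comb_operator[OF A] subspace_V] .
  have "A ` V \<noteq> {0}" using r dim_0_iff[OF fin_dim_subset[OF fin_dim_V AV] sAV] by auto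
  then obtain u where u: "u \<in> A ` V" "u \<noteq> 0" using subspace_0[OF sAV] by blast
  have "A (f u) \<in> span {u}" if "f \<in> comb j" for f j
    using that
  proof (induction)
    case comb_zero then show ?case by (simp add: A.zero span_zero)
  next
    case (comb_step f w c)
    then obtain d where "A (word w u) = d *s u" using sc u(1) by blast
    then show ?case using comb_step by (simp add: A.add A.scale span_add span_scale span_base)
  qed
  then have "A ` orbit (n - 1) u \<subseteq> span {u}" unfolding orbit_def by auto
  then have "A ` V \<subseteq> span {u}" using orbit_eq_V[of u] u AV by auto
  then have "dim (A ` V) \<le> card {u}" by (intro dim_le_card) auto
  then show False using r by simp
qed

text \<open>
  Write \<open>w = x\<^sub>j y\<^sub>j\<close> with \<open>x\<^sub>j\<close> of length \<open>j\<close>. The subspaces \<open>y\<^sub>0 Z, \<dots>, y\<^sub>L Z\<close>, for \<open>L\<close> the length of \<open>w\<close>,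
  are independent and all have the dimension of \<open>Z\<close>. To see this, apply \<open>A x\<^sub>p\<close>: for \<open>j > p\<close> the word \<open>x\<^sub>p y\<^sub>j\<close>
  is shorter than \<open>w\<close>, so \<open>A x\<^sub>p\<close> maps \<open>y\<^sub>j Z\<close> into \<open>Z\<close>, while it maps \<open>y\<^sub>p z\<close> to \<open>A w z\<close>, which is outside \<open>Z\<close> if
  \<open>z \<noteq> 0\<close>. The space \<open>T\<close> in the proof is the sum of the last \<open>d\<close> of these subspaces.
\<close>

lemma transversal_packing:
  assumes A: "A \<in> comb k" and w: "set w \<subseteq> S"
    and short: "\<And>v. set v \<subseteq> S \<Longrightarrow> length v < length w \<Longrightarrow> \<exists>c. \<forall>u\<in>A ` V. A (word v u) = c *s u"
    and Z: "Z \<subseteq> A ` V" "transversal (\<lambda>x. A (word w x)) Z"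
  shows "(length w + 1) * dim Z \<le> n"
proof -
  have sZ: "subspace Z" and tZ: "\<And>z. z \<in> Z \<Longrightarrow> A (word w z) \<in> Z \<Longrightarrow> z = 0"
    using Z(2) by (auto simp: transversal_def)
  have ZV: "Z \<subseteq> V" using Z(1) comb_V[OF A] by auto
  have fdZ: "fin_dim Z" by (rule fin_dim_subset[OF fin_dim_V ZV])
  define g where "g j = (\<lambda>x. A (word (take j w) x))" for j
  have tw: "set (take j w) \<subseteq> S" "set (drop j w) \<subseteq> S" for j
    using w set_take_subset[of j w] set_drop_subset[of j w] by auto
  have g: "operator (g j)" for j
    unfolding g_def by (rule comb_operator[OF comb_compose[OF A comb_word[OF tw(1) order_refl]]])
  have "d \<le> length w + 1 \<Longrightarrow> \<exists>T. subspace T \<and> T \<subseteq> V \<and> d * dim Z \<le> dim T \<and>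
      (\<forall>j < length w + 1 - d. \<forall>t\<in>T. g j t \<in> Z)" for d
  proof (induction d)
    case 0
    show ?case using subspace_V sZ
      by (intro exI[of _ "{0}"])
        (auto simp: subspace_single_0 subspace_0 endo.linear_0[OF g])
  next
    case (Suc d)
    then obtain T where T: "subspace T" "T \<subseteq> V" "d * dim Z \<le> dim T"
      and gT: "\<And>j t. j < length w + 1 - d \<Longrightarrow> t \<in> T \<Longrightarrow> g j t \<in> Z" by auto
    define p where "p = length w - d"
    have p: "p < length w + 1 - d" "p \<le> length w" "length w + 1 - Suc d = p"
      using Suc.prems by (auto simp: p_def)
    let ?y = "word (drop p w)"
    let ?Y = "?y ` Z"
    let ?T = "span (?Y \<union> T)"
    have fdT: "fin_dim T" by (rule fin_dim_subset[OF fin_dim_V T(2)])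
    have YV: "?Y \<subseteq> V" using word_V[OF tw(2)] ZV by auto
    have fdY: "fin_dim ?Y" by (rule fin_dim_subset[OF fin_dim_V YV])
    have sY: "subspace ?Y" by (rule endo.linear_subspace_image[OF operator_word[OF tw(2)] sZ])
    have z0: "z = 0" if "z \<in> Z" "?y z \<in> T" for z
    proof (rule tZ[OF that(1)])
      have "g p (?y z) = A (word w z)" by (simp add: g_def word_append[symmetric])
      then show "A (word w z) \<in> Z" using gT[OF p(1) that(2)] by simp
    qed
    have "{z \<in> Z. ?y z = 0} = {0}"
      using z0 T(1) sZ by (auto simp: subspace_0 endo.linear_0[OF operator_word[OF tw(2)]])
    then have "dim ?Y = dim Z"
      using rank_nullity[OF operator_word[OF tw(2)] sZ fdZ, of p] dim_0_iff[of "{0}"]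
        fin_dim_subset[OF fdZ, of "{0}"] sZ by (simp add: subspace_0 subspace_single_0)
    moreover have "?Y \<inter> T \<subseteq> {0}"
      using z0 endo.linear_0[OF operator_word[OF tw(2)]] by auto
    ultimately have "dim ?T = dim Z + dim T" using dim_direct_sum[OF sY fdY T(1) fdT] by simp
    then have "Suc d * dim Z \<le> dim ?T" using T(3) by simp
    moreover have "?T \<subseteq> V" using YV T(2) by (intro span_minimal subspace_V) auto
    moreover have "g j t \<in> Z" if j: "j < p" and t: "t \<in> ?T" for j t
    proof -
      have "?Y \<union> T \<subseteq> g j -` Z"
      proof
        fix x assume "x \<in> ?Y \<union> T"
        then show "x \<in> g j -` Z"
        proof
          assume "x \<in> ?Y"
          then obtain z where z: "z \<in> Z" "x = ?y z" by blast
          have "length (take j w @ drop p w) < length w" using j p(2) by simp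
          moreover have "set (take j w @ drop p w) \<subseteq> S" using tw by simp
          ultimately obtain c where "\<forall>u\<in>A ` V. A (word (take j w @ drop p w) u) = c *s u"
            using short by blast
          then have "g j x = c *s z" using z Z(1) by (auto simp: g_def word_append)
          then show ?thesis using z(1) sZ by (simp add: subspace_scale)
        qed (use gT[of j x] j p(1) in simp)
      qed
      then have "?T \<subseteq> g j -` Z"
        by (intro span_minimal endo.linear_subspace_vimage[OF g sZ])
      then show ?thesis using t by auto
    qed
    ultimately show ?case unfolding p(3) using subspace_span by blast
  qed
  from this[of "length w + 1"] obtain T where "T \<subseteq> V" "(length w + 1) * dim Z \<le> dim T" by auto
  then show ?thesis using dim_mono_fin_dim[OF fin_dim_V, of T] by simp
qed

lemma comb_shift_prod:
  assumes H: "H \<in> comb j"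
  shows "f \<in> comb m \<Longrightarrow> (\<lambda>x. shift_prod H ls (f x)) \<in> comb (m + length ls * j)"
proof (induction ls arbitrary: f m)
  case (Cons l ls)
  have "(\<lambda>x. H (f x) - l *s f x) \<in> comb (j + m)"
    using comb_compose[OF H Cons.prems] comb_mono[OF Cons.prems, of "j + m"]
    by (intro comb_diff comb_scale) auto
  from Cons.IH[OF this] show ?case by (simp add: algebra_simps)
qed simp

text \<open>
  The word \<open>w\<close> is a shortest one for which \<open>H = A w\<close> is not scalar on \<open>U\<close>. Let \<open>l\<close> be an eigenvalue of \<open>H\<close> on
  \<open>U\<close> with largest eigenspace, of dimension \<open>g\<close>, and \<open>\<rho>\<close> the rank of \<open>H - l\<close>. If \<open>\<rho> \<le> g\<close>, a single factor
  \<open>H - l\<close> at least halves the rank, and a transversal subspace of dimension \<open>\<rho>\<close> bounds the length of \<open>w\<close>.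
  If \<open>\<rho> > g\<close>, the product of factors given by \<open>eigen_product\<close> on the image of \<open>H - l\<close> is used in addition.
  It has at least one factor, so the rank is divided by three or more, and since every \<open>H - m\<close> has
  rank at least \<open>\<rho>\<close>, there is a transversal subspace of dimension at least \<open>\<rho> / 2\<close>.
\<close>

lemma rank_reduction:
  assumes A: "A \<in> comb k" and r: "2 \<le> dim (A ` V)"
  obtains k' A' where "A' \<in> comb k'" "0 < dim (A' ` V)"
    "2 * dim (A' ` V) \<le> dim (A ` V) \<and> k' * dim (A' ` V) \<le> k * dim (A ` V) + n \<or>
     3 * dim (A' ` V) \<le> dim (A ` V) \<and> k' * dim (A' ` V) \<le> k * dim (A ` V) + 2 * n"
proof -
  define U where "U = A ` V"
  define P where "P w \<longleftrightarrow> set w \<subseteq> S \<and> \<not> (\<exists>c. \<forall>u\<in>U. A (word w u) = c *s u)" for w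
  obtain w0 where "P w0" using nonscalar_word_exists[OF A r] unfolding P_def U_def by blast
  then obtain w where w: "P w" "\<And>v. P v \<Longrightarrow> length w \<le> length v"
    using ex_has_least_nat[of P w0 length] by blast
  define L where "L = length w"
  define H where "H = (\<lambda>x. A (word w x))"
  have wS: "set w \<subseteq> S" using w(1) by (simp add: P_def)
  have Hc: "H \<in> comb (k + L)" unfolding H_def L_def by (rule comb_compose[OF A comb_word[OF wS order_refl]])
  have H: "operator H" by (rule comb_operator[OF Hc])
  have UV: "U \<subseteq> V" using comb_V[OF A] by (auto simp: U_def)
  have sU: "subspace U" unfolding U_def by (rule endo.linear_subspace_image[OF comb_operator[OF A] subspace_V])
  have fdU: "fin_dim U" by (rule fin_dim_subset[OF fin_dim_V UV])
  have HU: "H x \<in> U" if "x \<in> U" for x using that UV word_V[OF wS] by (auto simp: H_def U_def)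
  have packing: "(L + 1) * dim Z \<le> n" if "Z \<subseteq> U" "transversal H Z" for Z
    unfolding L_def
  proof (rule transversal_packing[OF A wS])
    show "\<exists>c. \<forall>u\<in>A ` V. A (word v u) = c *s u" if "set v \<subseteq> S" "length v < length w" for v
      using w(2)[of v] that by (auto simp: P_def U_def)
  qed (use that in \<open>auto simp: U_def H_def\<close>)
  obtain l where l: "\<And>m. dim {x\<in>U. shift H m x = 0} \<le> dim {x\<in>U. shift H l x = 0}"
    by (rule max_eigenspace[OF fdU, where H = H]) auto
  define g where "g = dim {x\<in>U. shift H l x = 0}"
  define \<rho> where "\<rho> = dim (shift H l ` U)"
  have rn: "dim (shift H m ` U) + dim {x\<in>U. shift H m x = 0} = dim U" for m
    by (rule rank_nullity[OF operator_shift[OF H] sU fdU])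
  have sI: "subspace (shift H l ` U)" by (rule endo.linear_subspace_image[OF operator_shift[OF H] sU])
  have IU: "shift H l ` U \<subseteq> U" using HU sU by (auto intro: subspace_diff subspace_scale)
  have fdI: "fin_dim (shift H l ` U)" by (rule fin_dim_subset[OF fdU IU])
  have I0: "shift H l ` U \<noteq> {0}"
  proof
    assume 0: "shift H l ` U = {0}"
    have "H u = l *s u" if "u \<in> U" for u
      using imageI[OF that, of "shift H l"] 0 by simp
    then show False using w(1) by (auto simp: P_def H_def)
  qed
  have rho0: "0 < \<rho>" using dim_0_iff[OF fdI sI] I0 by (simp add: \<rho>_def)
  show ?thesis
  proof (cases "\<rho> \<le> g")
    case True
    obtain Z where Z: "transversal (shift H l) Z" "Z \<subseteq> U" "dim Z = \<rho>"
      unfolding \<rho>_def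
      by (rule transversal_of_small_rank[OF operator_shift[OF H] sU fdU])
        (use IU True in \<open>auto simp: \<rho>_def g_def\<close>)
    have pack: "(L + 1) * \<rho> \<le> n" using packing[OF Z(2) transversal_shift[OF Z(1)]] Z(3) by simp
    define A' where "A' = (\<lambda>x. shift_prod H [l] (A x))"
    have A': "A' \<in> comb (k + (k + L))" unfolding A'_def using comb_shift_prod[OF Hc A, of "[l]"] by simp
    have "A' ` V = shift H l ` U" by (simp add: A'_def U_def image_image)
    then have d: "dim (A' ` V) = \<rho>" by (simp add: \<rho>_def)
    have r2: "2 * \<rho> \<le> dim U" using rn[of l] True by (simp add: \<rho>_def g_def)
    have "(k + (k + L)) * \<rho> = k * (2 * \<rho>) + L * \<rho>" by (simp add: algebra_simps)
    also have "\<dots> \<le> k * dim U + n" using r2 pack by (intro add_mono mult_le_mono2) auto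
    finally show ?thesis using that[OF A'] d rho0 r2 by (simp add: U_def)
  next
    case False
    have II: "H x \<in> shift H l ` U" if "x \<in> shift H l ` U" for x
    proof -
      interpret H: Vector_Spaces.linear scale scale H by (rule H)
      obtain y where "y \<in> U" "x = shift H l y" using \<open>x \<in> shift H l ` U\<close> by blast
      then have "H x = shift H l (H y)" "H y \<in> U" using HU by (simp_all add: H.diff H.scale)
      then show ?thesis by blast
    qed
    have "\<exists>ls m. shift_prod H ls ` (shift H l ` U) \<noteq> {0} \<and>
        (length ls + 1) * dim (shift_prod H ls ` (shift H l ` U)) \<le> \<rho> \<and>
        shift_prod H ls ` (shift H l ` U) \<subseteq> shift H l ` U \<and>
        (\<forall>y\<in>shift_prod H ls ` (shift H l ` U). H y = m *s y)"
      unfolding \<rho>_def by (rule eigen_product[OF H sI fdI I0]) (rule II)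
    then obtain ls m Q where Q: "Q = shift_prod H ls ` (shift H l ` U)" and ls: "Q \<noteq> {0}"
      "(length ls + 1) * dim Q \<le> \<rho>" "Q \<subseteq> shift H l ` U" "\<forall>y\<in>Q. H y = m *s y"
      by (elim exE conjE) (rule that[OF refl]; assumption)
    define q where "q = dim Q"
    define A' where "A' = (\<lambda>x. shift_prod H (l # ls) (A x))"
    have A': "A' \<in> comb (k + length (l # ls) * (k + L))"
      unfolding A'_def by (rule comb_shift_prod[OF Hc A])
    have AQ: "A' ` V = Q" by (simp add: A'_def U_def Q image_image)
    have QU: "Q \<subseteq> U" using ls(3) IU by (rule subset_trans)
    have sQ: "subspace Q" unfolding AQ[symmetric]
      by (rule endo.linear_subspace_image[OF comb_operator[OF A'] subspace_V])
    have q0: "0 < q" using dim_0_iff[OF fin_dim_subset[OF fdU QU] sQ] ls(1) by (simp add: q_def)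
    have eig: "dim W \<le> g" if "W \<subseteq> U" "\<forall>y\<in>W. H y = m *s y" for W
    proof -
      have "W \<subseteq> {x\<in>U. shift H m x = 0}" using that by auto
      then have "dim W \<le> dim {x\<in>U. shift H m x = 0}"
        by (rule dim_mono_fin_dim[rotated]) (rule fin_dim_subset[OF fdU], auto)
      then show ?thesis using l[of m] by (simp add: g_def)
    qed
    have qg: "q \<le> g" unfolding q_def by (rule eig[OF QU ls(4)])
    have "ls \<noteq> []"
    proof
      assume "ls = []"
      then have "Q = shift H l ` U" using Q by (simp add: image_image)
      then have "q = \<rho>" by (simp add: q_def \<rho>_def)
      then show False using qg False by simp
    qed
    then have len: "1 \<le> length ls" by (cases ls) auto
    have dU: "\<rho> + g = dim U" using rn[of l] by (simp add: \<rho>_def g_def)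
    have lq: "(length ls + 1) * q \<le> \<rho>" using ls(2) by (simp add: q_def)
    then have r3: "(length ls + 2) * q \<le> dim U" using qg dU by simp
    have "3 * q \<le> (length ls + 2) * q" using len by (intro mult_le_mono1) simp
    then have r3': "3 * q \<le> dim U" using r3 by (rule order_trans)
    obtain Z where Z: "transversal H Z" "Z \<subseteq> U" "\<rho> \<le> 2 * dim Z"
    proof (rule transversal_of_rank_bound[OF H sU fdU HU])
      show "\<rho> \<le> dim (shift H m ` U)" for m using rn[of l] rn[of m] l[of m] by (simp add: \<rho>_def)
      show "\<rho> < dim U" using dU qg q0 by simp
    qed
    have pack: "(L + 1) * dim Z \<le> n" by (rule packing[OF Z(2,1)])
    have "(k + length (l # ls) * (k + L)) * q = k * ((length ls + 2) * q) + L * ((length ls + 1) * q)"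
      by (simp add: algebra_simps)
    also have "\<dots> \<le> k * dim U + L * (2 * dim Z)"
      using r3 lq Z(3) by (intro add_mono mult_le_mono2) auto
    also have "\<dots> \<le> k * dim U + 2 * n" using pack by (simp add: algebra_simps)
    finally show ?thesis using that[OF A'] q0 r3' by (simp add: AQ U_def q_def)
  qed
qed

text \<open>
  The bound \<open>k r \<le> (3/2) n log\<^sub>2 (n / r)\<close> is preserved by \<open>rank_reduction\<close>: the rank \<open>q\<close> reached from \<open>r\<close>
  satisfies \<open>1 \<le> (3/2) log\<^sub>2 (r / q)\<close> if it is at most \<open>r / 2\<close>, and \<open>2 \<le> (3/2) log\<^sub>2 (r / q)\<close> if it is at most \<open>r / 3\<close>.
\<close>

lemma rank_one_aux:
  "A \<in> comb k \<Longrightarrow> 0 < dim (A ` V) \<Longrightarrow>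
    real (k * dim (A ` V)) \<le> 3 / 2 * n * log 2 (n / dim (A ` V)) \<Longrightarrow>
    \<exists>k' A'. A' \<in> comb k' \<and> dim (A' ` V) = 1 \<and> real k' \<le> 3 / 2 * n * log 2 n"
proof (induction "dim (A ` V)" arbitrary: A k rule: less_induct)
  case less
  show ?case
  proof (cases "dim (A ` V) = 1")
    case True
    then show ?thesis using less.prems by (intro exI[of _ k] exI[of _ A]) simp
  next
    case False
    then have "2 \<le> dim (A ` V)" using less.prems(2) by simp
    then obtain k' A' where A': "A' \<in> comb k'" "0 < dim (A' ` V)" and step:
      "2 * dim (A' ` V) \<le> dim (A ` V) \<and> k' * dim (A' ` V) \<le> k * dim (A ` V) + n \<or>
       3 * dim (A' ` V) \<le> dim (A ` V) \<and> k' * dim (A' ` V) \<le> k * dim (A ` V) + 2 * n"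
      by (rule rank_reduction[OF less.prems(1)])
    define q where "q = dim (A' ` V)"
    define r where "r = dim (A ` V)"
    have q0: "0 < q" and r0: "0 < r" using A'(2) less.prems(2) by (simp_all add: q_def r_def)
    have "\<exists>c::real. real (k' * q) \<le> real (k * r) + c * n \<and> c \<le> 3 / 2 * log 2 (r / q)"
      using step
    proof
      assume a: "2 * dim (A' ` V) \<le> dim (A ` V) \<and> k' * dim (A' ` V) \<le> k * dim (A ` V) + n"
      then have "2 \<le> real r / q" using q0 by (simp add: q_def r_def field_simps)
      then have "1 \<le> log 2 (r / q)" by simp
      moreover have "real (k' * q) \<le> real (k * r + n)" using a unfolding q_def r_def of_nat_le_iff by blast
      ultimately show ?thesis by (intro exI[of _ 1]) simp
    next
      assume a: "3 * dim (A' ` V) \<le> dim (A ` V) \<and> k' * dim (A' ` V) \<le> k * dim (A ` V) + 2 * n"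
      then have 3: "3 \<le> real r / q" using q0 by (simp add: q_def r_def field_simps)
      \<comment> \<open>The inequality \<open>2\<^sup>4 \<le> 3\<^sup>3\<close> is what makes the factor \<open>3 / 2\<close> suffice.\<close>
      have "log 2 (2 ^ 4) = real 4" by (rule log_pow_cancel) auto
      then have "4 = log 2 16" by simp
      also have "\<dots> \<le> log 2 (3 ^ 3)" by simp
      also have "\<dots> = real 3 * log 2 3" by (rule log_nat_power) simp
      also have "\<dots> = 3 * log 2 3" by simp
      also have "\<dots> \<le> 3 * log 2 (r / q)" using 3 by simp
      finally have "2 \<le> 3 / 2 * log 2 (r / q)" by simp
      moreover have "real (k' * q) \<le> real (k * r + 2 * n)" using a unfolding q_def r_def of_nat_le_iff by blast
      ultimately show ?thesis by (intro exI[of _ 2]) simp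
    qed
    then obtain c :: real where c: "real (k' * q) \<le> real (k * r) + c * n" "c \<le> 3 / 2 * log 2 (r / q)" by blast
    have "real (k' * q) \<le> 3 / 2 * n * log 2 (n / r) + 3 / 2 * log 2 (r / q) * n"
      using c(1) less.prems(3) mult_right_mono[OF c(2), of n] unfolding r_def[symmetric] by linarith
    also have "\<dots> = 3 / 2 * n * (log 2 (n / r) + log 2 (r / q))" by (simp add: algebra_simps)
    also have "log 2 (n / r) + log 2 (r / q) = log 2 (n / q)"
      using n_pos r0 q0 by (simp add: log_divide)
    finally have inv: "real (k' * dim (A' ` V)) \<le> 3 / 2 * n * log 2 (n / dim (A' ` V))" by (simp add: q_def)
    have "dim (A' ` V) < dim (A ` V)" using step A'(2) by auto
    from less.hyps[OF this A'(1,2) inv] show ?thesis .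
  qed
qed

lemma rank_one_exists:
  obtains k A where "A \<in> comb k" "dim (A ` V) = 1" "real k \<le> 3 / 2 * n * log 2 n"
  using rank_one_aux[OF comb_id[of 0]] n_pos by auto

end

section \<open>From rank one to all operators\<close>

context irreducible_word_action
begin

text \<open>
  An operator \<open>A\<close> of rank one is \<open>\<phi>(x) u\<close> for a linear form \<open>\<phi>\<close>. The claim is that the forms \<open>\<phi> \<circ> f\<close>, with \<open>f\<close> a
  combination of words of length below \<open>n\<close>, contain a family dual to any independent set. They separate
  points, because the orbit of a nonzero vector is all of \<open>V\<close>. To add \<open>b\<close> to \<open>B\<close>, let \<open>p\<close> be the
  element of the span of \<open>B\<close> on which the forms for \<open>B\<close> take the same values as on \<open>b\<close>. A form that does
  not vanish on \<open>b - p\<close>, corrected to vanish on \<open>B\<close>, then does not vanish on \<open>b\<close>.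
\<close>

lemma dual_family:
  assumes A: "A \<in> comb k" "A ` V = span {u}" "u \<noteq> 0"
    and B: "finite B" "independent B" "B \<subseteq> V"
  shows "\<exists>F. \<forall>b\<in>B. F b \<in> comb (n - 1) \<and> (\<forall>c\<in>B. A (F b c) = (if c = b then u else 0))"
  using B
proof (induction B)
  case (insert b B)
  then obtain F where F: "\<And>c. c \<in> B \<Longrightarrow> F c \<in> comb (n - 1)"
    "\<And>c d. c \<in> B \<Longrightarrow> d \<in> B \<Longrightarrow> A (F c d) = (if d = c then u else 0)"
    using independent_mono[OF insert.prems(1), of B] by (auto simp: subset_insertI)
  interpret A: Vector_Spaces.linear scale scale A by (rule comb_operator[OF A(1)])
  have "\<exists>a. A y = a *s u" if "y \<in> V" for y
    using imageI[OF that, of A] A(2) by (auto simp: span_singleton)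
  then obtain \<phi> where \<phi>: "\<And>y. y \<in> V \<Longrightarrow> A y = \<phi> y *s u" by metis
  have FV: "F c y \<in> V" if "c \<in> B" "y \<in> V" for c y using comb_V[OF F(1)] that by blast
  have bV: "b \<in> V" "\<And>c. c \<in> B \<Longrightarrow> c \<in> V" using insert.prems(2) by auto
  define p where "p = (\<Sum>c\<in>B. \<phi> (F c b) *s c)"
  have "b \<notin> span B" using insert.prems(1) insert.hyps(2) by (simp add: independent_insert)
  moreover have "p \<in> span B" unfolding p_def by (intro span_sum span_scale span_base)
  ultimately have bp: "b - p \<noteq> 0" by auto
  have "p \<in> V" unfolding p_def by (intro subspace_sum subspace_V subspace_scale) (use bV in auto)
  then have "b - p \<in> V" using bV(1) subspace_V by (simp add: subspace_diff)
  then have "orbit (n - 1) (b - p) = V" using orbit_eq_V bp by blast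
  moreover have "\<exists>v\<in>V. A v \<noteq> 0"
  proof (rule ccontr)
    assume "\<not> ?thesis"
    then have "span {u} \<subseteq> {0}" using A(2) by auto
    then show False using A(3) span_base[of u "{u}"] by auto
  qed
  ultimately obtain v where v: "v \<in> orbit (n - 1) (b - p)" "A v \<noteq> 0" by auto
  from v(1) obtain f where "f \<in> comb (n - 1)" "v = f (b - p)" unfolding orbit_def by (rule imageE)
  then have f: "f \<in> comb (n - 1)" "A (f (b - p)) \<noteq> 0" using v(2) by auto
  interpret f: Vector_Spaces.linear scale scale f by (rule comb_operator[OF f(1)])
  have fV: "f y \<in> V" if "y \<in> V" for y using comb_V[OF f(1)] that by blast
  \<comment> \<open>The combination \<open>f\<close>, corrected by the dual family so that \<open>A h\<close> vanishes on \<open>B\<close>.\<close>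
  define h where "h = (\<lambda>x. f x - (\<Sum>c\<in>B. \<phi> (f c) *s F c x))"
  have h: "h \<in> comb (n - 1)" unfolding h_def
    by (intro comb_diff f(1) comb_sum comb_scale F(1))
  have Ah: "A (h x) = A (f x) - (\<Sum>c\<in>B. \<phi> (f c) *s A (F c x))" for x
    by (simp add: h_def A.diff A.sum A.scale)
  have hB: "A (h d) = 0" if "d \<in> B" for d
  proof -
    have "(\<Sum>c\<in>B. \<phi> (f c) *s A (F c d)) = (\<Sum>c\<in>B. if d = c then \<phi> (f c) *s u else 0)"
      using F(2) that by (intro sum.cong) auto
    also have "\<dots> = \<phi> (f d) *s u" using that insert.hyps(1) by simp
    finally show ?thesis using Ah \<phi>[OF fV] bV(2) that by simp
  qed
  have "A (h b) = A (f (b - p))"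
  proof -
    have "(\<Sum>c\<in>B. \<phi> (f c) *s A (F c b)) = (\<Sum>c\<in>B. \<phi> (F c b) *s A (f c))"
      using \<phi>[OF FV] \<phi>[OF fV] bV by (intro sum.cong) (auto simp: mult.commute)
    then show ?thesis by (simp add: Ah p_def f.diff f.sum f.scale A.diff A.sum A.scale)
  qed
  then have hb: "A (h b) \<noteq> 0" "A (h b) = \<phi> (h b) *s u"
    using f(2) \<phi> comb_V[OF h bV(1)] by auto
  define e where "e = inverse (\<phi> (h b))"
  have e: "e *s A (h b) = u" using hb by (auto simp: e_def)
  define G where "G c = (if c = b then (\<lambda>x. e *s h x) else (\<lambda>x. F c x - \<phi> (F c b) *s (e *s h x)))" for c
  have "G c \<in> comb (n - 1)" if "c \<in> insert b B" for c
  proof (cases "c = b")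
    case True
    show ?thesis unfolding G_def if_P[OF True] by (rule comb_scale[OF h])
  next
    case False
    show ?thesis unfolding G_def if_not_P[OF False]
      by (intro comb_scale comb_diff h F(1)) (use that False in auto)
  qed
  moreover have "A (G c d) = (if d = c then u else 0)" if "c \<in> insert b B" "d \<in> insert b B" for c d
  proof -
    have "A (F c d - \<phi> (F c b) *s (e *s h d)) = A (F c d) - \<phi> (F c b) *s (e *s A (h d))"
      by (simp add: A.diff A.scale)
    moreover have "A (F c b) = \<phi> (F c b) *s u" if "c \<in> B" using \<phi>[OF FV] that bV by blast
    ultimately show ?thesis
      using that insert.hyps(2) e hB[of d] F(2)[of c d]
      by (auto simp: G_def A.scale simp del: scale_scale)
  qed
  ultimately show ?case by blast
qed auto

text \<open>
  With a basis \<open>B\<close>, a dual family \<open>F\<close> for an operator \<open>A\<close> of rank one with image spanned by \<open>u\<close>, and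
  combinations \<open>G b\<close> of words that map \<open>u\<close> to \<open>h b\<close>, the sum of the operators \<open>G b A (F b)\<close> over \<open>b\<close> in \<open>B\<close>
  is \<open>h\<close>. Here \<open>F b\<close> and \<open>G b\<close> cost length \<open>n - 1\<close> each.
\<close>

theorem irreducible_full:
  "\<exists>k. real k \<le> 3 / 2 * n * log 2 n + 2 * n - 2 \<and>
    (\<forall>h. operator h \<longrightarrow> h ` V \<subseteq> V \<longrightarrow> (\<exists>f\<in>comb k. \<forall>x\<in>V. h x = f x))"
proof -
  obtain k A where A: "A \<in> comb k" "dim (A ` V) = 1" and k: "real k \<le> 3 / 2 * n * log 2 n"
    by (rule rank_one_exists)
  have AV: "A ` V \<subseteq> V" using comb_V[OF A(1)] by auto
  have fdAV: "fin_dim (A ` V)" by (rule fin_dim_subset[OF fin_dim_V AV])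
  have sAV: "subspace (A ` V)" by (rule endo.linear_subspace_image[OF comb_operator[OF A(1)] subspace_V])
  obtain C where C: "C \<subseteq> A ` V" "independent C" "A ` V \<subseteq> span C" "card C = dim (A ` V)"
    by (rule fin_dim_basis[OF fdAV])
  then obtain u where u: "C = {u}" using A(2) by (auto simp: card_1_singleton_iff)
  have u0: "u \<noteq> 0" using C(2) u by simp
  have Au: "A ` V = span {u}" using C(1,3) span_minimal[OF C(1) sAV] u by auto
  have uV: "u \<in> V" using C(1) u AV by auto
  obtain B where B: "B \<subseteq> V" "finite B" "independent B" "V \<subseteq> span B"
    by (rule fin_dim_basis[OF fin_dim_V])
  obtain F where F: "\<And>b. b \<in> B \<Longrightarrow> F b \<in> comb (n - 1)"
    "\<And>b c. b \<in> B \<Longrightarrow> c \<in> B \<Longrightarrow> A (F b c) = (if c = b then u else 0)"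
    using dual_family[OF A(1) Au u0 B(2,3,1)] by blast
  have "\<exists>f\<in>comb (n - 1 + (k + (n - 1))). \<forall>x\<in>V. h x = f x" if h: "operator h" "h ` V \<subseteq> V" for h
  proof -
    have "\<exists>g\<in>comb (n - 1). g u = h b" if "b \<in> B" for b
    proof -
      have "h b \<in> V" using that h(2) B(1) by auto
      then have "h b \<in> orbit (n - 1) u" using orbit_eq_V[OF uV u0] by simp
      then show ?thesis by (auto simp: orbit_def)
    qed
    then obtain G where G: "\<And>b. b \<in> B \<Longrightarrow> G b \<in> comb (n - 1)" "\<And>b. b \<in> B \<Longrightarrow> G b u = h b"
      by metis
    define f where "f = (\<lambda>x. \<Sum>b\<in>B. G b (A (F b x)))"
    have f: "f \<in> comb (n - 1 + (k + (n - 1)))"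
      unfolding f_def by (intro comb_sum comb_compose[OF G(1)] comb_compose[OF A(1)] F(1))
    have "h c = f c" if "c \<in> B" for c
    proof -
      have "f c = (\<Sum>b\<in>B. if c = b then h b else 0)"
        unfolding f_def using F(2) G that
        by (intro sum.cong) (auto simp: endo.linear_0[OF comb_operator[OF G(1)]])
      also have "\<dots> = h c" using that B(2) by simp
      finally show ?thesis ..
    qed
    then have "h x = f x" if "x \<in> V" for x
      using endo.linear_eq_on[OF h(1) comb_operator[OF f], of x B] that B(4) by auto
    then show ?thesis using f by blast
  qed
  moreover have "real (n - 1 + (k + (n - 1))) \<le> 3 / 2 * n * log 2 n + 2 * n - 2"
    using k n_pos by (simp add: of_nat_diff)
  ultimately show ?thesis by blast
qed

end

section \<open>Invariant subspaces\<close>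

context word_action
begin

definition invariant_subspace :: "'b set \<Rightarrow> bool" where
  "invariant_subspace W \<longleftrightarrow> subspace W \<and> (\<forall>s\<in>S. \<forall>x\<in>W. act s x \<in> W)"

text \<open>
  On the quotient \<open>M / N\<close>, every word of length \<open>k + 1\<close> is a combination of shorter ones.
\<close>

definition reduces :: "nat \<Rightarrow> 'b set \<Rightarrow> 'b set \<Rightarrow> bool" where
  "reduces k M N \<longleftrightarrow> (\<forall>w. set w \<subseteq> S \<longrightarrow> length w = k + 1 \<longrightarrow>
    (\<exists>f\<in>comb k. \<forall>x\<in>M. word w x - f x \<in> N))"

lemma invariant_comb: "invariant_subspace W \<Longrightarrow> f \<in> comb k \<Longrightarrow> x \<in> W \<Longrightarrow> f x \<in> W"
  using comb_invariant unfolding invariant_subspace_def by blast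

lemma invariant_word: "invariant_subspace W \<Longrightarrow> set w \<subseteq> S \<Longrightarrow> x \<in> W \<Longrightarrow> word w x \<in> W"
  using invariant_comb[OF _ comb_word[of w "length w"]] by simp

text \<open>
  If \<open>v - g\<close> maps \<open>M\<close> into \<open>P\<close> and \<open>u - f\<close> maps \<open>P\<close> into \<open>N\<close>, then \<open>(u - f) (v - g)\<close> maps \<open>M\<close> into \<open>N\<close>. So \<open>u v\<close>
  agrees on \<open>M / N\<close> with \<open>u g + f v - f g\<close>, which has smaller length.
\<close>

lemma reduces_trans:
  assumes "reduces j M P" "reduces k P N"
  shows "reduces (j + k + 1) M N"
  unfolding reduces_def
proof (intro allI impI)
  fix w assume w: "set w \<subseteq> S" "length w = j + k + 1 + 1"
  define u where "u = take (k + 1) w"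
  define v where "v = drop (k + 1) w"
  have uv: "w = u @ v" "length u = k + 1" "length v = j + 1"
    using w(2) by (auto simp: u_def v_def)
  have S: "set u \<subseteq> S" "set v \<subseteq> S" using w(1) uv(1) by auto
  obtain g where g: "g \<in> comb j" "\<And>x. x \<in> M \<Longrightarrow> word v x - g x \<in> P"
    using assms(1) S(2) uv(3) unfolding reduces_def by blast
  obtain f where f: "f \<in> comb k" "\<And>x. x \<in> P \<Longrightarrow> word u x - f x \<in> N"
    using assms(2) S(1) uv(2) unfolding reduces_def by blast
  interpret u: Vector_Spaces.linear scale scale "word u" by (rule operator_word[OF S(1)])
  interpret f: Vector_Spaces.linear scale scale f by (rule comb_operator[OF f(1)])
  let ?h = "\<lambda>x. word u (g x) + f (word v x) - f (g x)"
  have "(\<lambda>x. word u (g x)) \<in> comb (j + k + 1)"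
    using comb_compose[OF comb_word[OF S(1) order_refl] g(1)] uv(2) by (simp add: add_ac)
  moreover have "(\<lambda>x. f (word v x)) \<in> comb (j + k + 1)"
    using comb_compose[OF f(1) comb_word[OF S(2) order_refl]] uv(3) by (simp add: add_ac)
  moreover have "(\<lambda>x. f (g x)) \<in> comb (j + k + 1)"
    using comb_mono[OF comb_compose[OF f(1) g(1)], of "j + k + 1"] by simp
  ultimately have "?h \<in> comb (j + k + 1)" by (intro comb_diff comb_add)
  moreover have "word w x - ?h x \<in> N" if "x \<in> M" for x
    using f(2)[OF g(2)[OF that]] by (simp add: uv(1) word_append u.diff f.diff algebra_simps)
  ultimately show "\<exists>h\<in>comb (j + k + 1). \<forall>x\<in>M. word w x - h x \<in> N" by (intro bexI[of _ ?h]) auto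
qed

text \<open>
  The letters act irreducibly on a complement \<open>C\<close> of \<open>N\<close> in \<open>M\<close>, through \<open>\<pi>\<close>, as they do on \<open>M / N\<close>. There
  \<open>irreducible_full\<close> expresses every operator, and in particular every word, by words of length at most \<open>k\<close>.
\<close>

lemma reduces_simple_quotient:
  assumes M: "invariant_subspace M" "fin_dim M" and N: "invariant_subspace N" "N \<subseteq> M" "N \<noteq> M"
    and simple: "\<And>P. invariant_subspace P \<Longrightarrow> N \<subseteq> P \<Longrightarrow> P \<subseteq> M \<Longrightarrow> P = N \<or> P = M"
    and d: "d = dim M - dim N"
  shows "\<exists>k. real k \<le> 3 / 2 * real d * log 2 (real d) + 2 * real d - 2 \<and> reduces k M N"
proof -
  have sM: "subspace M" and aM: "\<And>s x. s \<in> S \<Longrightarrow> x \<in> M \<Longrightarrow> act s x \<in> M"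
    and sN: "subspace N" and aN: "\<And>s x. s \<in> S \<Longrightarrow> x \<in> N \<Longrightarrow> act s x \<in> N"
    using M N by (auto simp: invariant_subspace_def)
  obtain \<pi> where p: "operator \<pi>" "\<And>x. x \<in> N \<Longrightarrow> \<pi> x = 0" "\<And>x. x \<in> M \<Longrightarrow> \<pi> x \<in> M"
    "\<And>x. x \<in> M \<Longrightarrow> x - \<pi> x \<in> N" "\<And>x. x \<in> M \<Longrightarrow> \<pi> (\<pi> x) = \<pi> x"
    by (rule complement_projection[OF sN sM N(2) M(2)]) blast
  interpret p: Vector_Spaces.linear scale scale \<pi> by (rule p(1))
  define C where "C = \<pi> ` M"
  have CM: "C \<subseteq> M" using p(3) by (auto simp: C_def)
  have pC: "\<pi> x = x" if "x \<in> C" for x using that p(5) by (auto simp: C_def)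
  have ker: "x \<in> N" if "x \<in> M" "\<pi> x = 0" for x using p(4)[OF that(1)] that(2) by simp
  have "{x \<in> M. \<pi> x = 0} = N" using ker p(2) N(2) by auto
  then have dC: "dim C = d" using rank_nullity[OF p(1) sM M(2)] by (simp add: C_def d)
  have sC: "subspace C" unfolding C_def by (rule endo.linear_subspace_image[OF p(1) sM])
  define act' where "act' s = (\<lambda>x. \<pi> (act s x))" for s
  interpret Q: irreducible_word_action scale S act' C
  proof (intro irreducible_word_action.intro word_action.intro word_action_axioms.intro
      irreducible_word_action_axioms.intro operator_space_axioms)
    show "operator (act' s)" if "s \<in> S" for s
      using Vector_Spaces.linear_compose[OF operator_act[OF that] p(1)] by (simp add: act'_def comp_def)
    show "subspace C" by (rule sC)
    show "fin_dim C" by (rule fin_dim_subset[OF M(2) CM])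
    show "C \<noteq> {0}"
    proof
      assume "C = {0}"
      then have "M \<subseteq> N" using ker by (auto simp: C_def)
      then show False using N by auto
    qed
    show "act' s x \<in> C" if "s \<in> S" "x \<in> C" for s x
      using that aM CM by (auto simp: act'_def C_def)
    fix W assume W: "subspace W" "W \<subseteq> C" "\<And>s x. s \<in> S \<Longrightarrow> x \<in> W \<Longrightarrow> act' s x \<in> W"
    \<comment> \<open>The preimage of an invariant subspace of the quotient is invariant.\<close>
    define P where "P = {x \<in> M. \<pi> x \<in> W}"
    have "subspace P" using sM W(1) by (auto simp: subspace_def P_def p.add p.scale p.zero)
    moreover have "act s x \<in> P" if "s \<in> S" "x \<in> P" for s x
    proof -
      interpret s: Vector_Spaces.linear scale scale "act s" by (rule operator_act[OF that(1)])
      have x: "x \<in> M" "\<pi> x \<in> W" using that by (auto simp: P_def)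
      have "\<pi> (act s (x - \<pi> x)) = 0" using p(2,4) aN that(1) x(1) by blast
      then have "\<pi> (act s x) = act' s (\<pi> x)" by (simp add: s.diff p.diff act'_def)
      then show ?thesis using W(3)[OF that(1) x(2)] aM[OF that(1) x(1)] by (simp add: P_def)
    qed
    ultimately have "invariant_subspace P" by (simp add: invariant_subspace_def)
    moreover have "N \<subseteq> P" using N(2) p(2) W(1) by (auto simp: P_def subspace_0)
    ultimately have "P = N \<or> P = M" using simple by (auto simp: P_def)
    moreover have WP: "W \<subseteq> P" using W(2) CM pC by (auto simp: P_def)
    have "W = {0}" if "P = N"
    proof -
      have "x = 0" if x: "x \<in> W" for x
      proof -
        have "x \<in> N" "x \<in> C" using x WP W(2) \<open>P = N\<close> by blast+
        then show ?thesis using p(2) pC by metis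
      qed
      then show ?thesis using subspace_0[OF W(1)] by auto
    qed
    moreover have "W = C" if "P = M" using that W(2) by (auto simp: P_def C_def)
    ultimately show "W = {0} \<or> W = C" by blast
  qed
  have word': "Q.word w x = \<pi> (word w x)" if "set w \<subseteq> S" "x \<in> C" for w x
    using that
  proof (induction w)
    case Nil then show ?case by (simp add: pC)
  next
    case (Cons s w)
    interpret s: Vector_Spaces.linear scale scale "act s" using Cons.prems by (intro operator_act) simp
    define y where "y = word w x"
    have "y \<in> M" unfolding y_def using invariant_word[OF M(1)] Cons.prems CM by auto
    then have "\<pi> (act s (y - \<pi> y)) = 0" using p(2,4) aN Cons.prems by auto
    then have "\<pi> (act s y) = act' s (\<pi> y)" by (simp add: s.diff p.diff act'_def)
    then show ?case using Cons by (simp add: y_def)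
  qed
  have comb': "\<exists>f\<in>comb k. \<forall>x\<in>C. g x = \<pi> (f x)" if "g \<in> Q.comb k" for g k
    using that
  proof (induction)
    case comb_zero
    show ?case using comb.comb_zero[of k] p.zero by (intro bexI[of _ "\<lambda>x. 0"]) auto
  next
    case (comb_step g w c)
    then obtain f where "f \<in> comb k" "\<forall>x\<in>C. g x = \<pi> (f x)" by blast
    then show ?case using comb.comb_step[of f k w c] comb_step.hyps word'
      by (intro bexI[of _ "\<lambda>x. c *s word w x + f x"]) (auto simp: p.add p.scale)
  qed
  obtain k where k: "real k \<le> 3 / 2 * real d * log 2 (real d) + 2 * real d - 2"
    and full: "\<And>h. operator h \<Longrightarrow> h ` C \<subseteq> C \<Longrightarrow> \<exists>f\<in>Q.comb k. \<forall>x\<in>C. h x = f x"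
    using Q.irreducible_full unfolding dC of_nat_mult of_nat_numeral by blast
  have "reduces k M N" unfolding reduces_def
  proof (intro allI impI)
    fix w assume w: "set w \<subseteq> S" "length w = k + 1"
    interpret w: Vector_Spaces.linear scale scale "word w" by (rule operator_word[OF w(1)])
    have "Q.word w ` C \<subseteq> C" using Q.word_V[OF w(1)] by auto
    then obtain g where g: "g \<in> Q.comb k" "\<forall>x\<in>C. Q.word w x = g x"
      using full[OF Q.operator_word[OF w(1)]] by blast
    obtain f where f: "f \<in> comb k" "\<And>x. x \<in> C \<Longrightarrow> g x = \<pi> (f x)" using comb'[OF g(1)] by blast
    interpret f: Vector_Spaces.linear scale scale f by (rule comb_operator[OF f(1)])
    have "word w x - f x \<in> N" if x: "x \<in> M" for x
    proof -
      have C: "\<pi> x \<in> C" using x by (simp add: C_def)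
      have xN: "x - \<pi> x \<in> N" by (rule p(4)[OF x])
      have 1: "word w (x - \<pi> x) - f (x - \<pi> x) \<in> N"
        using invariant_word[OF N(1) w(1) xN] invariant_comb[OF N(1) f(1) xN] sN by (simp add: subspace_diff)
      have "word w (\<pi> x) - f (\<pi> x) \<in> M"
        using invariant_word[OF M(1) w(1)] invariant_comb[OF M(1) f(1)] p(3)[OF x] sM by (simp add: subspace_diff)
      moreover have "\<pi> (word w (\<pi> x) - f (\<pi> x)) = 0"
        using g(2) f(2)[OF C] word'[OF w(1) C] C by (simp add: p.diff)
      ultimately have "word w (\<pi> x) - f (\<pi> x) \<in> N" by (rule ker)
      from subspace_add[OF sN 1 this] show ?thesis by (simp add: w.diff f.diff)
    qed
    then show "\<exists>f\<in>comb k. \<forall>x\<in>M. word w x - f x \<in> N" using f(1) by blast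
  qed
  then show ?thesis using k by blast
qed

lemma superadditive_bound:
  fixes a b :: nat
  assumes "0 < a" "0 < b"
  shows "3 / 2 * a * log 2 a + 3 / 2 * b * log 2 b \<le> 3 / 2 * real (a + b) * log 2 (real (a + b))"
proof -
  have "a * log 2 a \<le> a * log 2 (real (a + b))" "b * log 2 b \<le> b * log 2 (real (a + b))"
    using assms by (auto intro!: mult_left_mono)
  then show ?thesis by (simp add: algebra_simps)
qed

text \<open>
  Induction on the dimension of the quotient. An invariant subspace strictly between \<open>N\<close> and \<open>M\<close> splits
  the quotient into two smaller ones, for which the bounds \<open>j\<close> and \<open>k\<close> combine to \<open>j + k + 1\<close>. The terms
  \<open>- 2\<close> in the two bounds leave room for the additional \<open>1\<close>.
\<close>

theorem reduces_bound:
  assumes "invariant_subspace M" "fin_dim M" "invariant_subspace N" "N \<subseteq> M" "N \<noteq> M"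
  shows "\<exists>k. real k \<le> 3 / 2 * real (dim M - dim N) * log 2 (real (dim M - dim N))
    + 2 * real (dim M - dim N) - 2 \<and> reduces k M N"
  using assms
proof (induction "dim M - dim N" arbitrary: M N rule: less_induct)
  case less
  have lt: "dim N < dim M" if "invariant_subspace N" "N \<subseteq> M" "N \<noteq> M" "fin_dim M" for M N
    using subspace_eq_of_dim_le[OF that(4) _ that(2)] that(1,3) by (force simp: invariant_subspace_def)
  show ?case
  proof (cases "\<exists>P. invariant_subspace P \<and> N \<subseteq> P \<and> P \<subseteq> M \<and> P \<noteq> N \<and> P \<noteq> M")
    case False
    then show ?thesis by (intro reduces_simple_quotient[OF less.prems _ refl]) blast
  next
    case True
    then obtain P where P: "invariant_subspace P" "N \<subseteq> P" "P \<subseteq> M" "P \<noteq> N" "P \<noteq> M" by blast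
    have fdP: "fin_dim P" by (rule fin_dim_subset[OF less.prems(2) P(3)])
    define a b where "a = dim M - dim P" and "b = dim P - dim N"
    have ab: "0 < a" "0 < b" "dim M - dim N = a + b"
      using lt[OF P(1,3,5) less.prems(2)] lt[OF less.prems(3) P(2) P(4)[symmetric] fdP]
      by (auto simp: a_def b_def)
    obtain j where j: "real j \<le> 3 / 2 * a * log 2 a + 2 * a - 2" "reduces j M P"
      using less.hyps[OF _ less.prems(1,2) P(1,3,5)] ab unfolding a_def[symmetric] by auto
    obtain k where k: "real k \<le> 3 / 2 * b * log 2 b + 2 * b - 2" "reduces k P N"
      using less.hyps[OF _ P(1) fdP less.prems(3) P(2) P(4)[symmetric]] ab unfolding b_def[symmetric] by auto
    have "real (j + k + 1) \<le> 3 / 2 * real (a + b) * log 2 (real (a + b)) + 2 * real (a + b) - 2"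
      using j(1) k(1) superadditive_bound[OF ab(1,2)] by simp
    then show ?thesis using reduces_trans[OF j(2) k(2)] unfolding ab(3) by blast
  qed
qed

end

section \<open>Matrices\<close>

definition fscale :: "'k \<Rightarrow> ('i \<Rightarrow> 'k) \<Rightarrow> 'i \<Rightarrow> 'k::times" where
  "fscale c x = (\<lambda>i. c * x i)"

interpretation coords: operator_space "fscale :: 'k::alg_closed_field \<Rightarrow> (nat \<Rightarrow> 'k) \<Rightarrow> nat \<Rightarrow> 'k"
  by unfold_locales (auto simp: fscale_def fun_eq_iff algebra_simps)

text \<open>
  The space \<open>K\<^sup>n\<close> as a subspace of the space of all sequences, with the matrices acting on it.
\<close>

definition coord_space :: "nat \<Rightarrow> (nat \<Rightarrow> 'k::alg_closed_field) set" where
  "coord_space n = {x. \<forall>i\<ge>n. x i = 0}"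

definition unit_coord :: "nat \<Rightarrow> nat \<Rightarrow> 'k::alg_closed_field" where
  "unit_coord j = (\<lambda>i. if i = j then 1 else 0)"

lemma unit_coord_mem: "j < n \<Longrightarrow> unit_coord j \<in> coord_space n"
  by (auto simp: unit_coord_def coord_space_def)

lemma sum_fun_apply: "(\<Sum>a\<in>A. f a) i = (\<Sum>a\<in>A. f a i)"
  for f :: "'c \<Rightarrow> 'i \<Rightarrow> 'k::comm_monoid_add"
  by (induction A rule: infinite_finite_induct) auto

lemma coord_space_subspace: "coords.subspace (coord_space n)"
  by (auto simp: coords.subspace_def coord_space_def fscale_def)

lemma coord_space_dim:
  "coords.fin_dim (coord_space n :: (nat \<Rightarrow> 'k::alg_closed_field) set)"
  "coords.dim (coord_space n :: (nat \<Rightarrow> 'k::alg_closed_field) set) \<le> n"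
proof -
  let ?E = "unit_coord ` {..<n} :: (nat \<Rightarrow> 'k) set"
  have "x \<in> coords.span ?E" if "x \<in> coord_space n" for x
  proof -
    have "x = (\<Sum>j<n. fscale (x j) (unit_coord j))"
    proof
      fix i
      have "(\<Sum>j<n. fscale (x j) (unit_coord j)) i = (\<Sum>j<n. if i = j then x j else 0)"
        by (simp add: sum_fun_apply fscale_def unit_coord_def if_distrib cong: if_cong)
      then show "x i = (\<Sum>j<n. fscale (x j) (unit_coord j)) i"
        using that by (auto simp: coord_space_def)
    qed
    moreover have "(\<Sum>j<n. fscale (x j) (unit_coord j)) \<in> coords.span ?E"
      by (intro coords.span_sum coords.span_scale coords.span_base) auto
    ultimately show ?thesis by simp
  qed
  then have sub: "coord_space n \<subseteq> coords.span ?E" by blast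
  then show "coords.fin_dim (coord_space n :: (nat \<Rightarrow> 'k) set)" unfolding coords.fin_dim_def by blast
  have "coords.dim (coord_space n :: (nat \<Rightarrow> 'k) set) \<le> card ?E" by (rule coords.dim_le_card[OF sub]) simp
  also have "\<dots> \<le> n" using card_image_le[of "{..<n}" unit_coord] by simp
  finally show "coords.dim (coord_space n :: (nat \<Rightarrow> 'k) set) \<le> n" .
qed

definition mat_act :: "nat \<Rightarrow> 'a::field mat \<Rightarrow> (nat \<Rightarrow> 'a alg_closure) \<Rightarrow> nat \<Rightarrow> 'a alg_closure" where
  "mat_act n M x = (\<lambda>i. if i < n then \<Sum>j<n. to_ac (M $$ (i, j)) * x j else 0)"

lemma mat_act_operator: "coords.operator (mat_act n M)"
  unfolding Vector_Spaces.linear_iff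
  using coords.vector_space_axioms
  by (auto simp: mat_act_def fscale_def fun_eq_iff algebra_simps sum.distrib sum_distrib_left)

lemma mat_act_mem: "mat_act n M x \<in> coord_space n"
  by (auto simp: mat_act_def coord_space_def)

lemma mat_act_one: "x \<in> coord_space n \<Longrightarrow> mat_act n (1\<^sub>m n) x = x"
proof
  fix i assume x: "x \<in> coord_space n"
  have "(\<Sum>j<n. to_ac ((1\<^sub>m n) $$ (i, j)) * x j) = (\<Sum>j<n. if i = j then x j else 0)" if "i < n"
    using that by (intro sum.cong) auto
  then show "mat_act n (1\<^sub>m n) x i = x i" using x by (auto simp: mat_act_def coord_space_def)
qed

lemma mat_act_mult:
  assumes "A \<in> carrier_mat n n" "B \<in> carrier_mat n n"
  shows "mat_act n (A * B) x = mat_act n A (mat_act n B x)"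
proof
  fix i
  have "(\<Sum>j<n. to_ac ((A * B) $$ (i, j)) * x j) =
      (\<Sum>l<n. to_ac (A $$ (i, l)) * (\<Sum>j<n. to_ac (B $$ (l, j)) * x j))" if "i < n"
  proof -
    have "(A * B) $$ (i, j) = (\<Sum>l<n. A $$ (i, l) * B $$ (l, j))" if "j < n" for j
      using \<open>i < n\<close> that assms by (simp add: scalar_prod_def atLeast0LessThan)
    then have "(\<Sum>j<n. to_ac ((A * B) $$ (i, j)) * x j) =
        (\<Sum>j<n. \<Sum>l<n. to_ac (A $$ (i, l)) * (to_ac (B $$ (l, j)) * x j))"
      by (intro sum.cong) (auto simp: to_ac_sum sum_distrib_right mult.assoc)
    also have "\<dots> = (\<Sum>l<n. \<Sum>j<n. to_ac (A $$ (i, l)) * (to_ac (B $$ (l, j)) * x j))"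
      by (rule sum.swap)
    finally show ?thesis by (simp add: sum_distrib_left)
  qed
  then show "mat_act n (A * B) x i = mat_act n A (mat_act n B x) i" by (simp add: mat_act_def)
qed

lemma mat_act_unit_coord: "i < n \<Longrightarrow> j < n \<Longrightarrow> mat_act n M (unit_coord j) i = to_ac (M $$ (i, j))"
  by (simp add: mat_act_def unit_coord_def if_distrib[of "\<lambda>y. _ * y"] cong: if_cong)

text \<open>
  Such a retraction exists because \<open>1\<close> is part of a basis of the closure over the field. It allows a
  linear relation with coefficients in the closure to be replaced by one with coefficients in the field.
\<close>

lemma closure_retraction:
  obtains p :: "'a::field alg_closure \<Rightarrow> 'a" where
    "\<And>x y. p (x + y) = p x + p y" "\<And>c x. p (to_ac c * x) = c * p x" "p 1 = 1"
proof -
  interpret K: vector_space "\<lambda>(c::'a) (x::'a alg_closure). to_ac c * x"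
    by unfold_locales (auto simp: algebra_simps)
  interpret F: vector_space "(*) :: 'a \<Rightarrow> 'a \<Rightarrow> 'a"
    by unfold_locales (auto simp: algebra_simps)
  interpret KF: vector_space_pair "\<lambda>(c::'a) (x::'a alg_closure). to_ac c * x" "(*) :: 'a \<Rightarrow> 'a \<Rightarrow> 'a" ..
  have "K.independent {1}" by simp
  from KF.linear_independent_extend[OF this, of "\<lambda>_. 1"]
  obtain p where p: "Vector_Spaces.linear (\<lambda>(c::'a) (x::'a alg_closure). to_ac c * x) (*) p" "p 1 = 1" by auto
  interpret p: Vector_Spaces.linear "\<lambda>(c::'a) (x::'a alg_closure). to_ac c * x" "(*)" p by (rule p(1))
  show ?thesis by (rule that[OF p.add p.scale p(2)])
qed

interpretation mat_vs: Module.module "class_ring :: 'a::field ring" "module_mat TYPE('a) n n"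
  for n
  using matrix_vs[where ?'a = 'a, of n n] by (simp add: vectorspace_def)

lemma mat_subspace_iff:
  "VectorSpace.subspace class_ring A (module_mat TYPE('a::field) n n) \<longleftrightarrow>
    A \<subseteq> carrier_mat n n \<and> 0\<^sub>m n n \<in> A \<and> (\<forall>x\<in>A. \<forall>y\<in>A. x + y \<in> A) \<and> (\<forall>c. \<forall>x\<in>A. c \<cdot>\<^sub>m x \<in> A)"
  unfolding VectorSpace.subspace_def submodule_def
  using matrix_vs[where ?'a = 'a, of n n]
  by (auto simp: vectorspace_def matrix_vs_simps)

lemma mat_span_subspace:
  assumes "T \<subseteq> carrier_mat n n" shows "VectorSpace.subspace class_ring (mat_span n T) (module_mat TYPE('a::field) n n)"
  using mat_vs.span_is_submodule[of T n] assms matrix_vs[where ?'a = 'a, of n n]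
  by (simp add: VectorSpace.subspace_def matrix_vs_simps)

lemma mat_span_base: "T \<subseteq> carrier_mat n n \<Longrightarrow> x \<in> T \<Longrightarrow> x \<in> mat_span n T"
  using mat_vs.in_own_span[of T n] by (auto simp: matrix_vs_simps)

lemma mat_span_minimal:
  assumes "T \<subseteq> B" "VectorSpace.subspace class_ring B (module_mat TYPE('a::field) n n)"
  shows "mat_span n T \<subseteq> B"
  using mat_vs.span_is_subset[OF assms(1)] assms(2) by (simp add: VectorSpace.subspace_def)

context
  fixes n :: nat and S :: "'a::field mat set"
  assumes S: "S \<subseteq> carrier_mat n n"
begin

lemma word_prod_carrier: "set w \<subseteq> S \<Longrightarrow> word_prod n w \<in> carrier_mat n n"
  by (induction w) (use S in \<open>auto simp: word_prod_def\<close>)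

lemma word_prod_Cons: "word_prod n (s # w) = s * word_prod n w"
  by (simp add: word_prod_def)

lemma words_carrier: "{word_prod n w | w. set w \<subseteq> S \<and> length w \<le> k} \<subseteq> carrier_mat n n"
  using word_prod_carrier by auto

lemma words_span_subspace: "VectorSpace.subspace class_ring (words_span n S k) (module_mat TYPE('a) n n)"
  unfolding words_span_def by (rule mat_span_subspace[OF words_carrier])

lemma words_span_word: "set w \<subseteq> S \<Longrightarrow> length w \<le> k \<Longrightarrow> word_prod n w \<in> words_span n S k"
  unfolding words_span_def by (rule mat_span_base[OF words_carrier]) auto

lemma words_span_minimal:
  assumes "VectorSpace.subspace class_ring B (module_mat TYPE('a) n n)"
    "\<And>w. set w \<subseteq> S \<Longrightarrow> length w \<le> k \<Longrightarrow> word_prod n w \<in> B"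
  shows "words_span n S k \<subseteq> B"
  unfolding words_span_def by (rule mat_span_minimal[OF _ assms(1)]) (use assms(2) in auto)

text \<open>
  If words of length \<open>k + 1\<close> are combinations of words of length at most \<open>k\<close>, then these combinations are
  closed under left multiplication by letters, hence by words, and so form an algebra.
\<close>

lemma words_span_eq_gen_algebra:
  assumes "\<And>w. set w \<subseteq> S \<Longrightarrow> length w = k + 1 \<Longrightarrow> word_prod n w \<in> words_span n S k"
  shows "words_span n S k = gen_algebra n S"
proof
  let ?A = "words_span n S k"
  have A: "?A \<subseteq> carrier_mat n n" "0\<^sub>m n n \<in> ?A" "\<And>x y. x \<in> ?A \<Longrightarrow> y \<in> ?A \<Longrightarrow> x + y \<in> ?A"
    "\<And>c x. x \<in> ?A \<Longrightarrow> c \<cdot>\<^sub>m x \<in> ?A"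
    using words_span_subspace[of k] unfolding mat_subspace_iff by auto
  have left: "s * x \<in> ?A" if s: "s \<in> S" and x: "x \<in> ?A" for s x
  proof -
    have sc: "s \<in> carrier_mat n n" using s S by auto
    have "?A \<subseteq> {x \<in> carrier_mat n n. s * x \<in> ?A}"
    proof (rule words_span_minimal)
      show "VectorSpace.subspace class_ring {x \<in> carrier_mat n n. s * x \<in> ?A} (module_mat TYPE('a) n n)"
        unfolding mat_subspace_iff using A sc
        by (auto simp: mult_add_distrib_mat[OF sc] mult_smult_distrib[OF sc])
      show "word_prod n w \<in> {x \<in> carrier_mat n n. s * x \<in> ?A}" if w: "set w \<subseteq> S" "length w \<le> k" for w
      proof -
        have "word_prod n (s # w) \<in> ?A"
        proof (cases "length w = k")
          case True
          then show ?thesis using s w by (intro assms) auto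
        qed (use s w in \<open>auto intro!: words_span_word\<close>)
        then show ?thesis using word_prod_carrier[OF w(1)] by (simp add: word_prod_Cons)
      qed
    qed
    then show ?thesis using x by auto
  qed
  have mult: "x * y \<in> ?A" if x: "x \<in> ?A" and y: "y \<in> ?A" for x y
  proof -
    have yc: "y \<in> carrier_mat n n" using y A(1) by auto
    have "?A \<subseteq> {x \<in> carrier_mat n n. x * y \<in> ?A}"
    proof (rule words_span_minimal)
      show "VectorSpace.subspace class_ring {x \<in> carrier_mat n n. x * y \<in> ?A} (module_mat TYPE('a) n n)"
        unfolding mat_subspace_iff using A yc
        by (auto simp: add_mult_distrib_mat[OF _ _ yc] mult_smult_assoc_mat[OF _ yc])
      show "word_prod n w \<in> {x \<in> carrier_mat n n. x * y \<in> ?A}" if w: "set w \<subseteq> S" "length w \<le> k" for w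
      proof -
        have "word_prod n w * y \<in> ?A" using w(1)
        proof (induction w)
          case Nil
          then show ?case using y yc by (simp add: word_prod_def)
        next
          case (Cons s w)
          have "word_prod n (s # w) * y = s * (word_prod n w * y)"
            unfolding word_prod_Cons using Cons.prems S word_prod_carrier[of w] yc by (intro assoc_mult_mat) auto
          then show ?case using Cons left by simp
        qed
        then show ?thesis using word_prod_carrier[OF w(1)] by simp
      qed
    qed
    then show ?thesis using x by auto
  qed
  have one: "1\<^sub>m n \<in> ?A" using words_span_word[of "[]" k] by (simp add: word_prod_def)
  have "S \<subseteq> ?A"
  proof
    fix s assume s: "s \<in> S"
    have "s * 1\<^sub>m n \<in> ?A" using left[OF s one] .
    then show "s \<in> ?A" using s S by auto
  qed
  moreover have "unital_subalgebra n ?A"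
    unfolding unital_subalgebra_def using words_span_subspace one mult by auto
  ultimately show "gen_algebra n S \<subseteq> ?A" unfolding gen_algebra_def by (rule hull_minimal)
  show "?A \<subseteq> gen_algebra n S"
    unfolding gen_algebra_def hull_def
  proof (rule Inter_greatest)
    fix B assume "B \<in> {t. unital_subalgebra n t \<and> S \<subseteq> t}"
    then have B: "unital_subalgebra n B" "S \<subseteq> B" by auto
    show "?A \<subseteq> B"
    proof (rule words_span_minimal)
      show "word_prod n w \<in> B" if "set w \<subseteq> S" for w
        using that by (induction w) (use B in \<open>auto simp: unital_subalgebra_def word_prod_def\<close>)
    qed (use B in \<open>simp add: unital_subalgebra_def\<close>)
  qed
qed

interpretation W: word_action "fscale :: 'a alg_closure \<Rightarrow> (nat \<Rightarrow> 'a alg_closure) \<Rightarrow> nat \<Rightarrow> 'a alg_closure"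
  S "mat_act n"
  by (intro word_action.intro word_action_axioms.intro coords.operator_space_axioms mat_act_operator)

lemma word_eq_mat_act:
  "set w \<subseteq> S \<Longrightarrow> x \<in> coord_space n \<Longrightarrow> W.word w x = mat_act n (word_prod n w) x"
proof (induction w)
  case Nil
  then show ?case by (simp add: word_prod_def mat_act_one)
next
  case (Cons s w)
  then have "s \<in> carrier_mat n n" "word_prod n w \<in> carrier_mat n n"
    using S word_prod_carrier[of w] by auto
  then show ?case using Cons by (simp add: word_prod_Cons mat_act_mult)
qed

text \<open>
  The matrix entries of a word are in the field, so applying the retraction to the entries leaves them
  unchanged, while it turns \<open>f\<close> into a combination of words with coefficients in the field.
\<close>

lemma word_prod_mem_of_comb:
  assumes w: "set w \<subseteq> S" and f: "f \<in> W.comb k" and eq: "\<And>x. x \<in> coord_space n \<Longrightarrow> W.word w x = f x"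
  shows "word_prod n w \<in> words_span n S k"
proof -
  obtain p :: "'a alg_closure \<Rightarrow> 'a" where p: "\<And>x y. p (x + y) = p x + p y"
    "\<And>c x. p (to_ac c * x) = c * p x" "p 1 = 1"
    by (rule closure_retraction) (rule that)
  have p0: "p 0 = 0" using p(2)[of 0 0] by simp
  have pac: "p (to_ac c) = c" for c using p(2)[of c 1] p(3) by simp
  have A: "words_span n S k \<subseteq> carrier_mat n n" "0\<^sub>m n n \<in> words_span n S k"
    "\<And>x y. x \<in> words_span n S k \<Longrightarrow> y \<in> words_span n S k \<Longrightarrow> x + y \<in> words_span n S k"
    "\<And>c x. x \<in> words_span n S k \<Longrightarrow> c \<cdot>\<^sub>m x \<in> words_span n S k"
    using words_span_subspace[of k] unfolding mat_subspace_iff by auto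
  have "\<exists>M\<in>words_span n S k. \<forall>i<n. \<forall>j<n. M $$ (i, j) = p (f (unit_coord j) i)"
    using f
  proof (induction)
    case comb_zero
    show ?case by (intro bexI[OF _ A(2)]) (simp add: p0)
  next
    case (comb_step f v c)
    then obtain M where M: "M \<in> words_span n S k" "\<And>i j. i < n \<Longrightarrow> j < n \<Longrightarrow> M $$ (i, j) = p (f (unit_coord j) i)"
      by blast
    let ?P = "word_prod n v"
    have P: "?P \<in> carrier_mat n n" using word_prod_carrier comb_step by blast
    have mem: "p c \<cdot>\<^sub>m ?P + M \<in> words_span n S k"
      using M(1) words_span_word comb_step A by auto
    have "(p c \<cdot>\<^sub>m ?P + M) $$ (i, j) = p ((fscale c (W.word v (unit_coord j)) + f (unit_coord j)) i)"
      if ij: "i < n" "j < n" for i j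
    proof -
      have "W.word v (unit_coord j) i = to_ac (?P $$ (i, j))"
        using word_eq_mat_act[OF comb_step(2) unit_coord_mem[OF ij(2)]] mat_act_unit_coord[OF ij] by metis
      then have "p ((fscale c (W.word v (unit_coord j)) + f (unit_coord j)) i)
          = p (to_ac (?P $$ (i, j)) * c) + p (f (unit_coord j) i)"
        by (simp add: fscale_def p(1) mult.commute)
      also have "\<dots> = ?P $$ (i, j) * p c + M $$ (i, j)" using p(2) M(2)[OF ij] by simp
      finally show ?thesis using ij P M(1) A(1) by (auto simp: mult.commute)
    qed
    then show ?case using mem by blast
  qed
  then obtain M where M: "M \<in> words_span n S k" "\<And>i j. i < n \<Longrightarrow> j < n \<Longrightarrow> M $$ (i, j) = p (f (unit_coord j) i)"
    by blast
  have "M = word_prod n w"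
  proof (rule eq_matI)
    have c: "M \<in> carrier_mat n n" "word_prod n w \<in> carrier_mat n n" using M(1) A(1) word_prod_carrier[OF w] by auto
    then show "dim_row M = dim_row (word_prod n w)" "dim_col M = dim_col (word_prod n w)" by auto
    fix i j assume "i < dim_row (word_prod n w)" "j < dim_col (word_prod n w)"
    then have ij: "i < n" "j < n" using c by auto
    have "f (unit_coord j) i = to_ac (word_prod n w $$ (i, j))"
      using eq[OF unit_coord_mem[OF ij(2)]] word_eq_mat_act[OF w unit_coord_mem[OF ij(2)]]
        mat_act_unit_coord[OF ij] by metis
    then show "M $$ (i, j) = word_prod n w $$ (i, j)" using M(2)[OF ij] pac by simp
  qed
  then show ?thesis using M(1) by simp
qed

lemma alg_length_bound:
  assumes n: "0 < n"
  shows "real (alg_length n S) \<le> 3 / 2 * n * log 2 n + 2 * n - 2"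
proof -
  let ?V = "coord_space n :: (nat \<Rightarrow> 'a alg_closure) set"
  have V: "W.invariant_subspace ?V" "W.invariant_subspace {0}"
    using coord_space_subspace mat_act_mem coords.endo.linear_0[OF mat_act_operator]
    by (auto simp: W.invariant_subspace_def coords.subspace_single_0)
  have "unit_coord 0 \<in> ?V" using n by (rule unit_coord_mem)
  moreover have "unit_coord 0 \<noteq> (0 :: nat \<Rightarrow> 'a alg_closure)"
  proof
    assume "unit_coord 0 = (0 :: nat \<Rightarrow> 'a alg_closure)"
    then have "unit_coord 0 0 = (0 :: nat \<Rightarrow> 'a alg_closure) 0" by simp
    then show False by (simp add: unit_coord_def)
  qed
  ultimately have V0: "{0} \<noteq> ?V" by blast
  have z: "{0} \<subseteq> ?V" using coords.subspace_0[OF coord_space_subspace] by auto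
  define d where "d = coords.dim ?V"
  have "coords.dim {0 :: nat \<Rightarrow> 'a alg_closure} = 0" using coords.dim_le_card[of "{0}" "{}"] by simp
  then obtain k where k: "real k \<le> 3 / 2 * real d * log 2 (real d) + 2 * real d - 2" "W.reduces k ?V {0}"
    using W.reduces_bound[OF V(1) coord_space_dim(1) V(2) z V0] by (auto simp: d_def)
  have "d \<noteq> 0" using coords.dim_0_iff[OF coord_space_dim(1) coord_space_subspace] V0 by (auto simp: d_def)
  have "d \<le> n" unfolding d_def by (rule coord_space_dim(2))
  have "real d * log 2 (real d) \<le> real n * log 2 (real n)"
    using \<open>d \<noteq> 0\<close> \<open>d \<le> n\<close> by (intro mult_mono) auto
  then have kn: "real k \<le> 3 / 2 * n * log 2 n + 2 * n - 2" using k(1) \<open>d \<le> n\<close> by simp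
  have "word_prod n w \<in> words_span n S k" if w: "set w \<subseteq> S" "length w = k + 1" for w
  proof -
    obtain f where "f \<in> W.comb k" "\<forall>x\<in>?V. W.word w x - f x \<in> {0}"
      using k(2) w unfolding W.reduces_def by blast
    then show ?thesis by (intro word_prod_mem_of_comb[OF w(1), of f]) auto
  qed
  then have "words_span n S k = gen_algebra n S" by (rule words_span_eq_gen_algebra)
  then have "alg_length n S \<le> k" unfolding alg_length_def by (rule Least_le)
  then show ?thesis using kn by linarith
qed

end

section \<open>The bound for the length\<close>

text \<open>
  With \<open>x = log\<^sub>2 n\<close> the claim reduces to \<open>2 log\<^sub>2 x \<le> x / 2 + 3\<close>, that is, to \<open>log\<^sub>2 y \<le> y - 1 / 2\<close> for
  \<open>y = x / 4\<close>. This follows from \<open>ln (c y) \<le> c y - 1\<close> with \<open>c = 3 / 5\<close>, a rational number below \<open>ln 2\<close>.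
\<close>

lemma log_log_bound:
  fixes n :: nat
  assumes "1 < n"
  shows "3 / 2 * n * log 2 n + 2 * n - 2 \<le> 2 * real n * log 2 (real n) - 2 * real n * log 2 (log 2 (real n)) + 5 * real n"
proof -
  define y where "y = log 2 n / 4"
  have "1 \<le> log 2 n" using assms by simp
  then have y: "0 < y" by (simp add: y_def)
  \<comment> \<open>Bounds for \<open>ln 2\<close> and \<open>ln (5 / 3)\<close> come from \<open>2 = (6 / 5) (5 / 4) (4 / 3)\<close> and
    \<open>1 - 1 / a \<le> ln a \<le> a - 1\<close> for each factor.\<close>
  define p q r :: real where "p = ln (6 / 5)" and "q = ln (5 / 4)" and "r = ln (4 / 3)"
  have ln_bounds: "1 - 1 / a \<le> ln a" "ln a \<le> a - 1" if "0 < a" for a :: real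
    using that ln_le_minus_one[of a] ln_le_minus_one[of "1 / a"] by (simp_all add: ln_div)
  have pqr: "1 / 6 \<le> p" "1 / 5 \<le> q" "1 / 4 \<le> r" "p \<le> 1 / 5" "q \<le> 1 / 4" "r \<le> 1 / 3"
    using ln_bounds[of "6 / 5"] ln_bounds[of "5 / 4"] ln_bounds[of "4 / 3"] by (simp_all add: p_def q_def r_def)
  have ln2: "ln 2 = p + q + r"
    using ln_mult[of "6 / 5 :: real" "5 / 4 * (4 / 3)"] ln_mult[of "5 / 4 :: real" "4 / 3"]
    by (simp add: p_def q_def r_def)
  have "ln (3 / 5 * y) \<le> 3 / 5 * y - 1" using y by (intro ln_le_minus_one) simp
  moreover have "ln (3 / 5 * y) = ln y - (q + r)"
  proof -
    have "q + r = ln (5 / 3)" using ln_mult[of "5 / 4 :: real" "4 / 3"] by (simp add: q_def r_def)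
    then show ?thesis using y by (simp add: ln_mult ln_div)
  qed
  moreover have "3 / 5 * y \<le> ln 2 * y" using pqr y unfolding ln2 by (intro mult_right_mono) auto
  moreover have "ln 2 * (y - 1 / 2) = ln 2 * y - (p + q + r) / 2"
    unfolding right_diff_distrib using ln2 by simp
  moreover have "3 * (q + r) + p \<le> 2" using pqr by simp
  ultimately have "ln y \<le> ln 2 * (y - 1 / 2)" by argo
  then have "log 2 y \<le> y - 1 / 2" by (simp add: log_def field_simps)
  moreover have "log 2 (log 2 n) = log 2 (4 * y)" by (simp add: y_def)
  moreover have "log 2 (4 * y) = log 2 4 + log 2 y" using y by (simp add: log_mult)
  moreover have "log 2 (2 ^ 2) = real 2" by (rule log_pow_cancel) auto
  ultimately have "log 2 (log 2 n) \<le> log 2 n / 4 + 3 / 2" by (simp add: y_def)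
  then have "real n * (2 * log 2 (log 2 n)) \<le> real n * (log 2 n / 2 + 3)" by (intro mult_left_mono) auto
  then show ?thesis by (simp add: algebra_simps)
qed

theorem theoremA:
  fixes n :: nat
  assumes "n > 1"
  shows "(\<forall>S :: 'a::field mat set. S \<subseteq> carrier_mat n n \<longrightarrow>
            real (alg_length n S) \<le>
              2 * real n * log 2 (real n) - 2 * real n * log 2 (log 2 (real n)) + 5 * real n) \<and>
         real (full_length TYPE('a) n) \<le>
           2 * real n * log 2 (real n) - 2 * real n * log 2 (log 2 (real n)) + 5 * real n"
proof
  let ?b = "2 * real n * log 2 (real n) - 2 * real n * log 2 (log 2 (real n)) + 5 * real n"
  have bound: "real (alg_length n S) \<le> ?b" if "S \<subseteq> carrier_mat n n" for S :: "'a mat set"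
    using alg_length_bound[OF that] log_log_bound[OF assms] assms by simp
  then show "\<forall>S :: 'a mat set. S \<subseteq> carrier_mat n n \<longrightarrow> real (alg_length n S) \<le> ?b" by blast
  let ?L = "{alg_length n S | S :: 'a mat set. S \<subseteq> carrier_mat n n \<and> gen_algebra n S = carrier_mat n n}"
  have "?L \<subseteq> {..nat \<lfloor>?b\<rfloor>}"
  proof
    fix l assume "l \<in> ?L"
    then have "real l \<le> ?b" using bound by blast
    then show "l \<in> {..nat \<lfloor>?b\<rfloor>}" unfolding atMost_iff by (rule le_nat_floor)
  qed
  then have "finite ?L" using finite_subset by blast
  moreover have "gen_algebra n (carrier_mat n n :: 'a mat set) = carrier_mat n n"
    unfolding gen_algebra_def
    by (rule hull_same) (auto simp: unital_subalgebra_def mat_subspace_iff)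
  then have "?L \<noteq> {}" by blast
  ultimately have "Max ?L \<in> ?L" by (rule Max_in)
  then show "real (full_length TYPE('a) n) \<le> ?b" unfolding full_length_def using bound by auto
qed

end
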